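(* Let $X$ be a symmetric sequence space on $\mathbb R^n$ with $\|(1,0,\dots,0)\|_X=1$. (a) There exists a constant $c>0$ such that if $(x_{i,j})_{1\le i,j\le n}$ is an $n\times n$ matrix, then $$\frac1{n!}\sum_{\pi\in S_n}\big\|(x_{i,\pi(i)})_{1\le i\le n}\big\|_X\ge c^{-1}\left(\frac1n\sum_{k=1}^nx_k^*+\big\|(x_{kn}^* )_{1\le k\le n}\big\|_X\right).$$ (b) Furthermore, if the associated r.i. space $E_X$ is $D^*$-convex, then there exists a constant $c>0$ such that if $(x_{i,j})_{1\le i,j\le n}$ is an $n\times n$ matrix, then $$\frac1{n!}\sum_{\pi\in S_n}\big\|(x_{i,\pi(i)})_{1\le i\le n}\big\|_X\le c\left(\frac1n\sum_{k=1}^nx_k^*+\big\|(x_{kn}^* )_{1\le k\le n}\big\|_X\right).$$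
   Context: Matrices are real. $S_n$ is the group of permutations of $\{1,\dots,n\}$; $x_1^*\ge x_2^*\ge\dots\ge x_{n^2}^*$ is the decreasing rearrangement of the numbers $|x_{i,j}|$. A symmetric sequence space $X$ on $\mathbb R^n$ is $\mathbb R^n$ with a norm that is monotone in the absolute values of the coordinates and invariant under permutations and sign changes of coordinates. Its associated rearrangement invariant (r.i.) space $E_X$ is the space of functions on $[0,1]$ with norm $$\|x\|_{E_X}=\Big\|\Big(\frac1n\int_{(i-1)/n}^{i/n}x^*(s)\,ds\Big)_{1\le i\le n}\Big\|_X,$$ where $x^*$ is the decreasing rearrangement of $|x|$. For functions $x_1,\dots,x_m$ on $[0,1]$ let $C(x_1,\dots,x_m)(t)=|x_k(mt-k+1)|$ for $(k-1)/m<t<k/m$. An r.i. space $E$ on $[0,1]$ is $D^*$-convex if there is a constant $K>0$ such that $\|C(x_1,\dots,x_m)\|_E\ge K^{-1}\inf_{1\le k\le m}\|x_k\|_E$ for all $m$ and all $x_1,\dots,x_m$. *)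

theory Defs
  imports "HOL-Analysis.Analysis" "HOL-Combinatorics.Permutations" "HOL-Library.Multiset"
begin

text \<open>
  Since constants have to be uniform in the dimension \<open>n\<close>, vectors in \<open>\<real>\<^sup>n\<close> are functions
  \<open>nat \<Rightarrow> real\<close> of which only the coordinates in \<open>{1..n}\<close> matter; likewise for \<open>n \<times> n\<close> matrices.
\<close>

locale symmetric_sequence_space =
  fixes n :: nat and N :: "(nat \<Rightarrow> real) \<Rightarrow> real"
  assumes dim_pos: "n \<ge> 1"
    and coordinates: "\<And>x y. (\<And>i. i \<in> {1..n} \<Longrightarrow> x i = y i) \<Longrightarrow> N x = N y"
    and nonneg: "\<And>x. N x \<ge> 0"
    and eq_zero_iff: "\<And>x. N x = 0 \<longleftrightarrow> (\<forall>i\<in>{1..n}. x i = 0)"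
    and scale: "\<And>a x. N (\<lambda>i. a * x i) = \<bar>a\<bar> * N x"
    and triangle: "\<And>x y. N (\<lambda>i. x i + y i) \<le> N x + N y"
    and monotone: "\<And>x y. (\<And>i. i \<in> {1..n} \<Longrightarrow> \<bar>x i\<bar> \<le> \<bar>y i\<bar>) \<Longrightarrow> N x \<le> N y"
    and permute: "\<And>x \<pi>. \<pi> permutes {1..n} \<Longrightarrow> N (\<lambda>i. x (\<pi> i)) = N x"
    and sign: "\<And>x \<epsilon>. (\<And>i. i \<in> {1..n} \<Longrightarrow> \<epsilon> i \<in> {-1, 1}) \<Longrightarrow> N (\<lambda>i. \<epsilon> i * x i) = N x"

text \<open>The \<open>k\<close>-th largest of the numbers \<open>\<bar>x i j\<bar>\<close>, counted with multiplicity, for \<open>k \<in> {1..n\<^sup>2}\<close>.\<close>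

definition matrix_rearr :: "nat \<Rightarrow> (nat \<Rightarrow> nat \<Rightarrow> real) \<Rightarrow> nat \<Rightarrow> real" where
  "matrix_rearr n x k =
     rev (sorted_list_of_multiset
       (image_mset (\<lambda>(i, j). \<bar>x i j\<bar>) (mset_set ({1..n} \<times> {1..n})))) ! (k - 1)"

text \<open>
  Functions on \<open>[0,1]\<close> are functions \<open>real \<Rightarrow> real\<close> whose values outside \<open>{0..1}\<close> are ignored.
  For measurable \<open>f\<close> the infimum below is over a nonempty set whenever \<open>s > 0\<close>; the value at
  \<open>s = 0\<close> is irrelevant, as the rearrangement is only integrated.
\<close>

definition decr_rearr :: "(real \<Rightarrow> real) \<Rightarrow> real \<Rightarrow> real" where
  "decr_rearr f s = Inf {t. t \<ge> 0 \<and> measure lebesgue {u \<in> {0..1}. \<bar>f u\<bar> > t} \<le> s}"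

definition ri_norm :: "nat \<Rightarrow> ((nat \<Rightarrow> real) \<Rightarrow> real) \<Rightarrow> (real \<Rightarrow> real) \<Rightarrow> real" where
  "ri_norm n N f =
     N (\<lambda>i. 1 / real n * (LINT s:{(real i - 1) / real n..real i / real n}|lebesgue. decr_rearr f s))"

text \<open>
  The functions for which the integrals in \<^const>\<open>ri_norm\<close> are finite. The Bochner integral
  is \<open>0\<close> on non-integrable functions, so the norm is only meaningful on this carrier.
\<close>

definition ri_carrier :: "nat \<Rightarrow> (real \<Rightarrow> real) set" where
  "ri_carrier n = {f. f \<in> borel_measurable (lebesgue_on {0..1}) \<and>
     (\<forall>i\<in>{1..n}. set_integrable lebesgue {(real i - 1) / real n..real i / real n} (decr_rearr f))}"

definition concat_fun :: "nat \<Rightarrow> (nat \<Rightarrow> real \<Rightarrow> real) \<Rightarrow> real \<Rightarrow> real" where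
  "concat_fun m x t =
     (\<Sum>k=1..m. indicator {(real k - 1) / real m<..<real k / real m} t * \<bar>x k (real m * t - real k + 1)\<bar>)"

text \<open>
  \<open>D\<^sup>*\<close>-convexity, with constant \<open>K\<close>, of the space with carrier \<open>E\<close> and norm \<open>nrm\<close>;
  the space is \<open>D\<^sup>*\<close>-convex if this holds for some \<open>K > 0\<close>.
\<close>

definition Dstar_convex_with ::
  "real \<Rightarrow> (real \<Rightarrow> real) set \<Rightarrow> ((real \<Rightarrow> real) \<Rightarrow> real) \<Rightarrow> bool" where
  "Dstar_convex_with K E nrm \<longleftrightarrow>
     (\<forall>m\<ge>1. \<forall>x. (\<forall>k\<in>{1..m}. x k \<in> E) \<longrightarrow>
        nrm (concat_fun m x) \<ge> inverse K * (INF k\<in>{1..m}. nrm (x k)))"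

definition perm_average :: "nat \<Rightarrow> ((nat \<Rightarrow> real) \<Rightarrow> real) \<Rightarrow> (nat \<Rightarrow> nat \<Rightarrow> real) \<Rightarrow> real" where
  "perm_average n N x = 1 / fact n * (\<Sum>\<pi> | \<pi> permutes {1..n}. N (\<lambda>i. x i (\<pi> i)))"

definition rearr_bound :: "nat \<Rightarrow> ((nat \<Rightarrow> real) \<Rightarrow> real) \<Rightarrow> (nat \<Rightarrow> nat \<Rightarrow> real) \<Rightarrow> real" where
  "rearr_bound n N x =
     1 / real n * (\<Sum>k=1..n. matrix_rearr n x k) + N (\<lambda>k. matrix_rearr n x (k * n))"

end

theory Submission
  imports Defs
begin

text \<open>
  The average over permutations is an average over injections, which can be computed by choosing the
  values one row after the other.

  For the lower bound, the numbers of the \<open>n\<close> and of the \<open>k n\<close> largest entries that lie on a random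
  permutation are controlled by their first two moments. The former bounds the maximal entry on the
  permutation; by the latter, with probability at least \<open>1/12\<close>, at least \<open>k/2\<close> of the \<open>k n\<close> largest
  entries lie on the permutation, and the triangle inequality for the averaged decreasing
  rearrangements gives the second term.

  For the upper bound, the \<open>n\<close> largest entries contribute the first term. For the others, apply
  \<open>D\<^sup>*\<close>-convexity to the concatenation of the vectors along those injections from a set of rows to a
  set of at least \<open>n/2\<close> columns along which the norm is large: these cannot make up more than half of
  the injections. Since this holds uniformly in the rows and columns, revealing the values row by row
  until the norm exceeds the bound on the median turns it into a bound on the mean.
\<close>

subsection \<open>Decreasing enumerations\<close>

text \<open>Sorting the elements by their values, rather than the values alone, attaches to every
  rank a position where the ranked value is attained. Ties are thereby broken once and for all, so
  that counting ranks counts positions.\<close>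

lemma decreasing_enumeration:
  fixes f :: "'a \<Rightarrow> real"
  assumes "finite A"
  obtains e where "bij_betw e {1..card A} A"
    and "\<And>k. k \<in> {1..card A} \<Longrightarrow>
      rev (sorted_list_of_multiset (image_mset f (mset_set A))) ! (k - 1) = f (e k)"
    and "\<And>k l. 1 \<le> k \<Longrightarrow> k \<le> l \<Longrightarrow> l \<le> card A \<Longrightarrow> f (e l) \<le> f (e k)"
proof -
  obtain as where as: "set as = A" "distinct as"
    using finite_distinct_list[OF assms] by blast
  define L where "L = rev (sort_key f as)"
  have L: "set L = A" "distinct L" "length L = card A"
    using as by (auto simp: L_def distinct_card)
  have "sort (map f as) = map f (sort_key f as)"
    by (intro properties_for_sort) auto
  moreover have "image_mset f (mset_set A) = mset (map f as)"
    using as by (simp add: mset_set_set[symmetric])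
  ultimately have list: "rev (sorted_list_of_multiset (image_mset f (mset_set A))) = map f L"
    by (simp only: L_def rev_map sorted_list_of_multiset_mset)
  have bij: "bij_betw (\<lambda>k. L ! (k - 1)) {1..card A} A"
  proof -
    have "bij_betw (\<lambda>k. k - 1) {1..card A} {..<card A}"
      by (rule bij_betwI[of _ _ _ Suc]) auto
    from bij_betw_trans[OF this bij_betw_nth[OF L(2)]] L show ?thesis
      by (auto simp: o_def)
  qed
  have "f (L ! (l - 1)) \<le> f (L ! (k - 1))" if "1 \<le> k" "k \<le> l" "l \<le> card A" for k l
  proof -
    have "sorted (rev (map f L))"
      by (simp add: L_def rev_map[symmetric])
    then have "sorted_wrt (\<ge>) (map f L)"
      by (simp add: sorted_wrt_rev)
    then show ?thesis
      using that L(3) sorted_wrt_nth_less[of "(\<ge>)" "map f L" "k - 1" "l - 1"]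
      by (cases "k = l") auto
  qed
  with bij list L(3) show ?thesis
    by (intro that[of "\<lambda>k. L ! (k - 1)"]) auto
qed

subsection \<open>Averages over injections\<close>

text \<open>Extensionality outside \<open>I\<close> makes the set finite and counts each injection
  once. Rows and columns are separate sets because fixing one value leaves an injection from the
  other rows to the other columns.\<close>

definition injections :: "'a set \<Rightarrow> 'b set \<Rightarrow> ('a \<Rightarrow> 'b) set" where
  "injections I J = {\<sigma>. \<sigma> \<in> I \<rightarrow>\<^sub>E J \<and> inj_on \<sigma> I}"

definition inj_average :: "'a set \<Rightarrow> 'b set \<Rightarrow> (('a \<Rightarrow> 'b) \<Rightarrow> real) \<Rightarrow> real" where
  "inj_average I J F = (\<Sum>\<sigma>\<in>injections I J. F \<sigma>) / real (card (injections I J))"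

lemma finite_injections [simp]: "finite I \<Longrightarrow> finite J \<Longrightarrow> finite (injections I J)"
  unfolding injections_def by (rule finite_subset[OF _ finite_PiE]) auto

lemma injections_ne:
  assumes "finite I" "finite J" "card I \<le> card J"
  shows "injections I J \<noteq> {}"
proof -
  obtain f where "f ` I \<subseteq> J" "inj_on f I"
    using card_le_inj[OF assms] by blast
  then have "restrict f I \<in> injections I J"
    by (auto simp: injections_def)
  then show ?thesis by blast
qed

lemma card_injections_pos:
  assumes "finite I" "finite J" "card I \<le> card J"
  shows "card (injections I J) > 0"
  using injections_ne[OF assms] finite_injections[OF assms(1,2)] by (simp add: card_gt_0_iff)

lemma card_injections_cong:
  assumes "finite I" "finite J" "finite J'" "card J = card J'"
  shows "card (injections I J) = card (injections I J')"
  using card_inj_on_subset_funcset[of I J I] card_inj_on_subset_funcset[of I J' I] assms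
  by (simp add: injections_def)

lemma inj_average_empty [simp]: "inj_average {} J F = F (\<lambda>_. undefined)"
  by (simp add: inj_average_def injections_def)

text \<open>The law of total expectation with respect to the value \<open>c\<close> in row
  \<open>r\<close>. This value is uniform on \<open>J\<close> because the number of injections
  extending a choice of \<open>c\<close> is the same for every \<open>c\<close>, by
  \<open>card_injections_cong\<close>.\<close>

lemma inj_average_insert:
  assumes "finite I" "finite J" "r \<notin> I" "card I < card J"
  shows "inj_average (insert r I) J F =
    (\<Sum>c\<in>J. inj_average I (J - {c}) (\<lambda>\<sigma>. F (\<sigma>(r := c)))) / real (card J)"
proof -
  have fin: "finite (injections I (J - {c}))" for c
    using assms by simp
  have "{(c, \<sigma>). c \<in> J \<and> \<sigma> \<in> I \<rightarrow>\<^sub>E (J - {c}) \<and> inj_on \<sigma> I} = Sigma J (\<lambda>c. injections I (J - {c}))"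
    by (auto simp: injections_def)
  then have img: "injections (insert r I) J = (\<lambda>(c, \<sigma>). \<sigma>(r := c)) ` Sigma J (\<lambda>c. injections I (J - {c}))"
    and inj: "inj_on (\<lambda>(c, \<sigma>). \<sigma>(r := c)) (Sigma J (\<lambda>c. injections I (J - {c})))"
    using extensional_funcset_extend_domain_inj_on_eq[OF assms(3), of J]
      extensional_funcset_extend_domain_inj_onI[OF assms(3), of J]
    by (simp_all add: injections_def)
  define q where "q = card (injections I (J - {SOME c. c \<in> J}))"
  have "J \<noteq> {}" using assms by auto
  then have J: "(SOME c. c \<in> J) \<in> J" by (simp add: some_in_eq)
  have q: "card (injections I (J - {c})) = q" if "c \<in> J" for c
    unfolding q_def using that J assms by (intro card_injections_cong) auto
  have sum: "(\<Sum>\<sigma>\<in>injections (insert r I) J. G \<sigma>) =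
      (\<Sum>c\<in>J. \<Sum>\<sigma>\<in>injections I (J - {c}). G (\<sigma>(r := c)))" for G :: "_ \<Rightarrow> real"
    unfolding img using assms(2) fin
    by (subst sum.reindex[OF inj]) (simp add: sum.Sigma split_def)
  have "real (card (injections (insert r I) J)) = real (card J) * real q"
    using sum[of "\<lambda>_. 1"] q by simp
  then show ?thesis
    unfolding inj_average_def sum
    by (simp add: q sum_divide_distrib mult.commute)
qed

lemma inj_average_const [simp]:
  assumes "finite I" "finite J" "card I \<le> card J"
  shows "inj_average I J (\<lambda>_. c) = c"
  using card_injections_pos[OF assms] by (simp add: inj_average_def)

lemma inj_average_mono:
  assumes "\<And>\<sigma>. \<sigma> \<in> injections I J \<Longrightarrow> F \<sigma> \<le> G \<sigma>"
  shows "inj_average I J F \<le> inj_average I J G"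
  unfolding inj_average_def by (intro divide_right_mono sum_mono assms) auto

lemma inj_average_cong:
  assumes "\<And>\<sigma>. \<sigma> \<in> injections I J \<Longrightarrow> F \<sigma> = G \<sigma>"
  shows "inj_average I J F = inj_average I J G"
  unfolding inj_average_def using assms by simp

lemma inj_average_add: "inj_average I J (\<lambda>\<sigma>. F \<sigma> + G \<sigma>) = inj_average I J F + inj_average I J G"
  by (simp add: inj_average_def sum.distrib add_divide_distrib)

lemma inj_average_diff: "inj_average I J (\<lambda>\<sigma>. F \<sigma> - G \<sigma>) = inj_average I J F - inj_average I J G"
  by (simp add: inj_average_def sum_subtractf diff_divide_distrib)

lemma inj_average_mult: "inj_average I J (\<lambda>\<sigma>. c * F \<sigma>) = c * inj_average I J F"
  by (simp add: inj_average_def sum_distrib_left)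

lemma inj_average_sum: "inj_average I J (\<lambda>\<sigma>. \<Sum>a\<in>A. F a \<sigma>) = (\<Sum>a\<in>A. inj_average I J (F a))"
  unfolding inj_average_def by (subst sum.swap) (simp add: sum_divide_distrib)

lemma inj_average_marginal:
  fixes g :: "'b \<Rightarrow> real"
  assumes "finite I" "finite J" "card I \<le> card J" "r \<in> I"
  shows "inj_average I J (\<lambda>\<sigma>. g (\<sigma> r)) = (\<Sum>c\<in>J. g c) / real (card J)"
proof -
  have "I = insert r (I - {r})" using assms(4) by blast
  moreover have *: "card (I - {r}) < card J"
    using assms by (metis card_Diff1_less order_less_le_trans)
  ultimately have "inj_average I J (\<lambda>\<sigma>. g (\<sigma> r)) =
      (\<Sum>c\<in>J. inj_average (I - {r}) (J - {c}) (\<lambda>\<sigma>. g c)) / real (card J)"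
    using inj_average_insert[of "I - {r}" J r "\<lambda>\<sigma>. g (\<sigma> r)"] assms by simp
  also have "\<dots> = (\<Sum>c\<in>J. g c) / real (card J)"
    using assms * by (intro arg_cong2[where f="(/)"] sum.cong refl inj_average_const) auto
  finally show ?thesis .
qed

text \<open>Two cells of one row exclude each other; for different rows, one value is revealed after
  the other. This is only an upper bound, since the cells may share a column. For
  \<open>card J = 1\<close> the right-hand side is \<open>1 / 0 = 0\<close>, which is correct as
  there is then just one row.\<close>

lemma inj_average_pair_le:
  assumes "finite I" "finite J" "card I \<le> card J" "r \<in> I" "s \<in> I" "(r, c) \<noteq> (s, d)"
  shows "inj_average I J (\<lambda>\<sigma>. of_bool (\<sigma> r = c) * of_bool (\<sigma> s = d))
    \<le> 1 / (real (card J) * real (card J - 1))"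
proof (cases "r = s")
  case True
  then have "inj_average I J (\<lambda>\<sigma>. of_bool (\<sigma> r = c) * of_bool (\<sigma> s = d)) = inj_average I J (\<lambda>\<sigma>. 0)"
    using assms by (intro inj_average_cong) auto
  moreover have "inj_average I J (\<lambda>\<sigma>. 0) = 0" by (simp add: inj_average_def)
  ultimately show ?thesis by simp
next
  case False
  have "I = insert r (I - {r})" using assms by blast
  moreover have *: "card (I - {r}) < card J"
    using assms by (metis card_Diff1_less order_less_le_trans)
  ultimately have "inj_average I J (\<lambda>\<sigma>. of_bool (\<sigma> r = c) * of_bool (\<sigma> s = d)) =
      (\<Sum>c'\<in>J. inj_average (I - {r}) (J - {c'}) (\<lambda>\<sigma>. of_bool (c' = c) * of_bool (\<sigma> s = d))) / real (card J)"
    using inj_average_insert[of "I - {r}" J r "\<lambda>\<sigma>. of_bool (\<sigma> r = c) * of_bool (\<sigma> s = d)"] assms False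
    by simp
  also have "\<dots> \<le> (\<Sum>c'\<in>J. of_bool (c' = c) * (1 / real (card J - 1))) / real (card J)"
  proof (intro divide_right_mono sum_mono)
    fix c' assume "c' \<in> J"
    then have "inj_average (I - {r}) (J - {c'}) (\<lambda>\<sigma>. of_bool (\<sigma> s = d)) =
        (\<Sum>d'\<in>J - {c'}. of_bool (d' = d)) / real (card J - 1)"
      using inj_average_marginal[of "I - {r}" "J - {c'}" s "\<lambda>d'. of_bool (d' = d)"] assms False * by simp
    also have "\<dots> \<le> 1 / real (card J - 1)"
      using assms(2) by (intro divide_right_mono) (auto simp: of_bool_def sum.delta)
    finally show "inj_average (I - {r}) (J - {c'}) (\<lambda>\<sigma>. of_bool (c' = c) * of_bool (\<sigma> s = d))
      \<le> of_bool (c' = c) * (1 / real (card J - 1))"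
      unfolding inj_average_mult by (intro mult_left_mono) auto
  qed auto
  also have "\<dots> \<le> 1 / real (card J - 1) / real (card J)"
    using assms(2) by (intro divide_right_mono) (auto simp: sum_divide_distrib[symmetric] of_bool_def sum.delta intro!: divide_right_mono)
  finally show ?thesis by (simp add: mult.commute)
qed

text \<open>A uniformly random injection of \<open>I'\<close> restricts to a uniformly random
  injection of \<open>I\<close>: revealing a row of \<open>I\<close> first on both sides leaves the
  same claim with one row and one column less.\<close>

lemma inj_average_restrict:
  assumes "finite I'" "finite J" "card I' \<le> card J" "I \<subseteq> I'"
  shows "inj_average I' J (\<lambda>\<sigma>. F (restrict \<sigma> I)) = inj_average I J F"
proof -
  have "finite I" using assms finite_subset by blast
  then show ?thesis
    using assms
  proof (induction I arbitrary: I' J F)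
    case empty
    then show ?case by (simp add: restrict_def)
  next
    case (insert r I)
    have I': "I' = insert r (I' - {r})" using insert.prems by blast
    have less: "card (I' - {r}) < card J"
      using insert.prems by (metis card_Diff1_less order_less_le_trans insert_subset)
    have upd: "restrict (\<sigma>(r := c)) (insert r I) = (restrict \<sigma> I)(r := c)" for \<sigma> :: "'a \<Rightarrow> 'b" and c
      using insert.hyps by (auto simp: restrict_def)
    have "card I \<le> card (I' - {r})"
      using insert by (intro card_mono) auto
    then have less': "card I < card J" using less by simp
    have "inj_average I' J (\<lambda>\<sigma>. F (restrict \<sigma> (insert r I))) =
        (\<Sum>c\<in>J. inj_average (I' - {r}) (J - {c}) (\<lambda>\<sigma>. F ((restrict \<sigma> I)(r := c)))) / real (card J)"
      by (subst I', subst inj_average_insert) (use insert.prems less in \<open>auto simp: upd simp del: restrict_upd\<close>)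
    also have "\<dots> = (\<Sum>c\<in>J. inj_average I (J - {c}) (\<lambda>\<sigma>. F (\<sigma>(r := c)))) / real (card J)"
      using insert.prems insert.hyps less
      by (intro arg_cong2[where f="(/)"] sum.cong refl insert.IH) auto
    also have "\<dots> = inj_average (insert r I) J F"
      using insert less' by (subst inj_average_insert) auto
    finally show ?case .
  qed
qed

text \<open>Restriction to \<open>{1..n}\<close> matches permutations, which are the identity
  outside, with extensional injections, since an injective self-map of a finite set is bijective.
  The hypothesis lets \<open>N\<close> ignore the different values outside.\<close>

lemma perm_average_eq_inj_average:
  assumes "\<And>x y. (\<And>i. i \<in> {1..n} \<Longrightarrow> x i = y i) \<Longrightarrow> N x = N y"
  shows "perm_average n N x = inj_average {1..n} {1..n} (\<lambda>\<sigma>. N (\<lambda>i. x i (\<sigma> i)))"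
proof -
  let ?S = "{1..n}"
  have bij: "bij_betw (\<lambda>\<pi>. restrict \<pi> ?S) {\<pi>. \<pi> permutes ?S} (injections ?S ?S)"
  proof (rule bij_betwI[where g="\<lambda>\<sigma> i. if i \<in> ?S then \<sigma> i else i"])
    show "(\<lambda>\<pi>. restrict \<pi> ?S) \<in> {\<pi>. \<pi> permutes ?S} \<rightarrow> injections ?S ?S"
    proof
      fix \<pi> assume "\<pi> \<in> {\<pi>. \<pi> permutes ?S}"
      then have \<pi>: "\<pi> permutes ?S" by simp
      then have "restrict \<pi> ?S \<in> ?S \<rightarrow>\<^sub>E ?S"
        unfolding restrict_PiE_iff using permutes_in_image[OF \<pi>] by blast
      moreover have "inj_on (restrict \<pi> ?S) ?S"
        using \<pi> unfolding inj_on_restrict_eq by (rule permutes_inj_on)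
      ultimately show "restrict \<pi> ?S \<in> injections ?S ?S"
        by (simp only: injections_def mem_Collect_eq)
    qed
    show "(\<lambda>\<sigma> i. if i \<in> ?S then \<sigma> i else i) \<in> injections ?S ?S \<rightarrow> {\<pi>. \<pi> permutes ?S}"
    proof
      fix \<sigma> assume "\<sigma> \<in> injections ?S ?S"
      then have "\<sigma> ` ?S \<subseteq> ?S" "inj_on \<sigma> ?S" by (auto simp: injections_def)
      then have "bij_betw \<sigma> ?S ?S"
        by (simp add: bij_betw_def endo_inj_surj)
      then have "bij_betw (\<lambda>i. if i \<in> ?S then \<sigma> i else i) ?S ?S"
        by (rule bij_betw_cong[THEN iffD1, rotated]) simp
      then show "(\<lambda>i. if i \<in> ?S then \<sigma> i else i) \<in> {\<pi>. \<pi> permutes ?S}"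
        by (simp, intro bij_imp_permutes) auto
    qed
    show "(\<lambda>i. if i \<in> ?S then restrict \<pi> ?S i else i) = \<pi>" if "\<pi> \<in> {\<pi>. \<pi> permutes ?S}" for \<pi>
      using that by (auto simp: restrict_def fun_eq_iff permutes_not_in)
    show "restrict (\<lambda>i. if i \<in> ?S then \<sigma> i else i) ?S = \<sigma>" if "\<sigma> \<in> injections ?S ?S" for \<sigma>
      using that by (auto simp: injections_def PiE_def extensional_def restrict_def fun_eq_iff)
  qed
  have "(\<Sum>\<sigma>\<in>injections ?S ?S. N (\<lambda>i. x i (\<sigma> i))) = (\<Sum>\<pi> | \<pi> permutes ?S. N (\<lambda>i. x i (restrict \<pi> ?S i)))"
    using sum.reindex_bij_betw[OF bij, of "\<lambda>\<sigma>. N (\<lambda>i. x i (\<sigma> i))"] by simp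
  also have "\<dots> = (\<Sum>\<pi> | \<pi> permutes ?S. N (\<lambda>i. x i (\<pi> i)))"
    by (intro sum.cong refl assms) simp
  moreover have "card (injections ?S ?S) = fact n"
    using bij_betw_same_card[OF bij] card_permutations[of ?S n] by simp
  ultimately show ?thesis
    by (simp add: perm_average_def inj_average_def)
qed

subsection \<open>Symmetric sequence spaces\<close>

context symmetric_sequence_space
begin

lemma norm_zero [simp]: "N (\<lambda>_. 0) = 0"
  by (simp add: eq_zero_iff)

lemma norm_abs: "N (\<lambda>i. \<bar>x i\<bar>) = N x"
  by (intro antisym monotone) auto

lemma norm_sum: "N (\<lambda>i. \<Sum>a\<in>A. f a i) \<le> (\<Sum>a\<in>A. N (f a))"
proof (induction A rule: infinite_finite_induct)
  case (insert a A)
  then show ?case using triangle[of "f a" "\<lambda>i. \<Sum>a\<in>A. f a i"] by simp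
qed auto

lemma norm_inj_average:
  "N (\<lambda>i. inj_average I J (\<lambda>\<sigma>. w \<sigma> i)) \<le> inj_average I J (\<lambda>\<sigma>. N (w \<sigma>))"
proof -
  let ?q = "real (card (injections I J))"
  have "N (\<lambda>i. inj_average I J (\<lambda>\<sigma>. w \<sigma> i)) = N (\<lambda>i. 1 / ?q * (\<Sum>\<sigma>\<in>injections I J. w \<sigma> i))"
    by (simp add: inj_average_def)
  also have "\<dots> = \<bar>1 / ?q\<bar> * N (\<lambda>i. \<Sum>\<sigma>\<in>injections I J. w \<sigma> i)"
    by (rule scale)
  also have "\<dots> \<le> \<bar>1 / ?q\<bar> * (\<Sum>\<sigma>\<in>injections I J. N (w \<sigma>))"
    by (intro mult_left_mono norm_sum) auto
  finally show ?thesis by (simp add: inj_average_def)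
qed

text \<open>\<open>S\<close> and its image have complements of equal size, so \<open>\<phi>\<close>
  extends to a permutation; setting coordinates to 0 then only lowers the norm.\<close>

lemma norm_reindex_le:
  assumes "S \<subseteq> {1..n}" "inj_on \<phi> S" "\<phi> ` S \<subseteq> {1..n}"
  shows "N (\<lambda>i. if i \<in> S then y (\<phi> i) else 0) \<le> N y"
proof -
  have "card ({1..n} - S) = card ({1..n} - \<phi> ` S)"
    using assms by (simp add: card_Diff_subset card_image finite_subset)
  then obtain g where g: "bij_betw g ({1..n} - S) ({1..n} - \<phi> ` S)"
    by (meson finite_Diff finite_atLeastAtMost finite_same_card_bij)
  define \<pi> where "\<pi> i = (if i \<in> S then \<phi> i else if i \<in> {1..n} then g i else i)" for i
  have "bij_betw \<pi> S (\<phi> ` S)"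
    using assms(2) by (auto simp: \<pi>_def bij_betw_def inj_on_def)
  moreover have "bij_betw \<pi> ({1..n} - S) ({1..n} - \<phi> ` S)"
    using g by (rule bij_betw_cong[THEN iffD1, rotated]) (auto simp: \<pi>_def)
  ultimately have "bij_betw \<pi> (S \<union> ({1..n} - S)) (\<phi> ` S \<union> ({1..n} - \<phi> ` S))"
    by (rule bij_betw_combine) auto
  then have "bij_betw \<pi> {1..n} {1..n}"
    using assms by (simp add: Un_absorb1)
  then have "\<pi> permutes {1..n}"
    using assms by (intro bij_imp_permutes) (auto simp: \<pi>_def)
  then have "N (\<lambda>i. y (\<pi> i)) = N y" by (rule permute)
  moreover have "N (\<lambda>i. if i \<in> S then y (\<phi> i) else 0) \<le> N (\<lambda>i. y (\<pi> i))"
    by (rule monotone) (auto simp: \<pi>_def)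
  ultimately show ?thesis by simp
qed

lemma norm_bij:
  assumes "bij_betw \<tau> {1..n} {1..n}"
  shows "N (\<lambda>i. y (\<tau> i)) = N y"
proof -
  let ?\<pi> = "\<lambda>i. if i \<in> {1..n} then \<tau> i else i"
  have "bij_betw ?\<pi> {1..n} {1..n}"
    using assms by (rule bij_betw_cong[THEN iffD1, rotated]) simp
  then have "?\<pi> permutes {1..n}" by (intro bij_imp_permutes) auto
  then have "N (\<lambda>i. y (?\<pi> i)) = N y" by (rule permute)
  moreover have "N (\<lambda>i. y (?\<pi> i)) = N (\<lambda>i. y (\<tau> i))" by (rule coordinates) simp
  ultimately show ?thesis by simp
qed

text \<open>The usual bound for dilation operators: \<open>\<phi>\<close> is injective on each of
  the \<open>d\<close> residue classes, and each class contributes at most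
  \<open>N y\<close>.\<close>

lemma norm_dilation_le:
  assumes "d > 0" "\<And>i. i \<in> {1..n} \<Longrightarrow> \<phi> i \<in> {1..n}"
    and "\<And>i j. i \<in> {1..n} \<Longrightarrow> j \<in> {1..n} \<Longrightarrow> \<phi> i = \<phi> j \<Longrightarrow> i mod d = j mod d \<Longrightarrow> i = j"
  shows "N (\<lambda>i. y (\<phi> i)) \<le> real d * N y"
proof -
  let ?S = "\<lambda>r. {i \<in> {1..n}. i mod d = r}"
  have "N (\<lambda>i. y (\<phi> i)) = N (\<lambda>i. \<Sum>r<d. if i \<in> ?S r then y (\<phi> i) else 0)"
    using assms(1) by (intro coordinates) (simp add: sum.delta')
  also have "\<dots> \<le> (\<Sum>r<d. N (\<lambda>i. if i \<in> ?S r then y (\<phi> i) else 0))"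
    by (rule norm_sum)
  also have "\<dots> \<le> (\<Sum>r<d. N y)"
  proof (rule sum_mono)
    fix r
    show "N (\<lambda>i. if i \<in> ?S r then y (\<phi> i) else 0) \<le> N y"
    proof (rule norm_reindex_le[of "?S r" \<phi> y])
      show "inj_on \<phi> (?S r)"
        by (rule inj_onI, rule assms(3)) auto
      show "\<phi> ` ?S r \<subseteq> {1..n}"
        using assms(2) by blast
    qed auto
  qed
  finally show ?thesis by simp
qed

end

section \<open>Normalized norms lie between the maximum norm and the sum norm\<close>

locale normalized_sequence_space = symmetric_sequence_space +
  assumes unit: "N (\<lambda>i. if i = 1 then 1 else 0) = 1"
begin

lemma norm_single:
  assumes "i \<in> {1..n}"
  shows "N (\<lambda>j. if j = i then a else 0) = \<bar>a\<bar>"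
proof -
  have "Transposition.transpose 1 i permutes {1..n}"
    using assms dim_pos by (intro permutes_swap_id) auto
  from permute[OF this, of "\<lambda>i. if i = 1 then 1 else 0"]
  have "N (\<lambda>j. if Transposition.transpose 1 i j = 1 then 1 else 0) = 1"
    using unit by simp
  moreover have "(\<lambda>j. if Transposition.transpose 1 i j = 1 then 1 else 0) = (\<lambda>j. if j = i then 1 else (0::real))"
    by (auto simp: fun_eq_iff Transposition.transpose_def)
  ultimately have "N (\<lambda>j. a * (if j = i then 1 else 0)) = \<bar>a\<bar>"
    by (subst scale) simp
  moreover have "(\<lambda>j. a * (if j = i then 1 else 0)) = (\<lambda>j. if j = i then a else 0)"
    by auto
  ultimately show ?thesis by simp
qed

lemma abs_coordinate_le: "i \<in> {1..n} \<Longrightarrow> \<bar>x i\<bar> \<le> N x"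
  using norm_single[of i "x i"] monotone[of "\<lambda>j. if j = i then x i else 0" x] by auto

lemma norm_le_sum: "N x \<le> (\<Sum>i\<in>{1..n}. \<bar>x i\<bar>)"
proof -
  have "N x = N (\<lambda>j. \<Sum>i\<in>{1..n}. if j = i then x i else 0)"
    by (intro coordinates) (simp add: sum.delta)
  also have "\<dots> \<le> (\<Sum>i\<in>{1..n}. N (\<lambda>j. if j = i then x i else 0))"
    by (rule norm_sum)
  also have "\<dots> = (\<Sum>i\<in>{1..n}. \<bar>x i\<bar>)"
    by (intro sum.cong refl norm_single)
  finally show ?thesis .
qed

end

text \<open>\<open>e\<close> turns events about values into events about fixed cells:
  \<open>e 1, ..., e k\<close> are exactly \<open>k\<close> cells carrying the \<open>k\<close>
  largest entries, even if there are ties.\<close>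

lemma matrix_rearr_enumeration:
  obtains e where "bij_betw e {1..n * n} ({1..n} \<times> {1..n})"
    and "\<And>k. k \<in> {1..n * n} \<Longrightarrow> matrix_rearr n x k = \<bar>x (fst (e k)) (snd (e k))\<bar>"
    and "\<And>k l. 1 \<le> k \<Longrightarrow> k \<le> l \<Longrightarrow> l \<le> n * n \<Longrightarrow> matrix_rearr n x l \<le> matrix_rearr n x k"
proof -
  let ?A = "{1..n} \<times> {1..n}"
  have card: "card ?A = n * n" by simp
  obtain e where e: "bij_betw e {1..card ?A} ?A"
    "\<And>k. k \<in> {1..card ?A} \<Longrightarrow> rev (sorted_list_of_multiset
      (image_mset (\<lambda>(i, j). \<bar>x i j\<bar>) (mset_set ?A))) ! (k - 1) = (\<lambda>(i, j). \<bar>x i j\<bar>) (e k)"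
    "\<And>k l. 1 \<le> k \<Longrightarrow> k \<le> l \<Longrightarrow> l \<le> card ?A \<Longrightarrow> (\<lambda>(i, j). \<bar>x i j\<bar>) (e l) \<le> (\<lambda>(i, j). \<bar>x i j\<bar>) (e k)"
    by (rule decreasing_enumeration[of ?A "\<lambda>(i, j). \<bar>x i j\<bar>"]) auto
  have eq: "matrix_rearr n x k = (\<lambda>(i, j). \<bar>x i j\<bar>) (e k)" if "k \<in> {1..n * n}" for k
    using e(2)[unfolded card, OF that] by (simp add: matrix_rearr_def)
  show ?thesis
  proof
    show "bij_betw e {1..n * n} ?A" using e(1) unfolding card .
    show "matrix_rearr n x k = \<bar>x (fst (e k)) (snd (e k))\<bar>" if "k \<in> {1..n * n}" for k
      using eq[OF that] by (simp add: case_prod_unfold)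
    show "matrix_rearr n x l \<le> matrix_rearr n x k" if "1 \<le> k" "k \<le> l" "l \<le> n * n" for k l
      using e(3)[of k l] eq[of k] eq[of l] that by simp
  qed
qed

subsection \<open>The lower bound\<close>

lemma hit_average:
  assumes "p \<in> {1..n} \<times> {1..n}"
  shows "inj_average {1..n} {1..n} (\<lambda>\<sigma>. of_bool (\<sigma> (fst p) = snd p)) = 1 / real n"
proof -
  have "inj_average {1..n} {1..n} (\<lambda>\<sigma>. of_bool (\<sigma> (fst p) = snd p)) = (\<Sum>c=1..n. of_bool (c = snd p)) / real n"
    using assms inj_average_marginal[of "{1..n}" "{1..n}" "fst p" "\<lambda>c. of_bool (c = snd p)"]
    by (simp add: mem_Times_iff)
  also have "(\<Sum>c=1..n. of_bool (c = snd p)) = (1::real)"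
    using assms by (simp add: of_bool_def mem_Times_iff)
  finally show ?thesis .
qed

lemma other_hits_average:
  assumes "bij_betw e {1..n * n} ({1..n} \<times> {1..n})" "L \<subseteq> {1..n * n}" "l \<in> L"
  shows "inj_average {1..n} {1..n} (\<lambda>\<sigma>. \<Sum>j\<in>L - {l}.
      of_bool (\<sigma> (fst (e l)) = snd (e l)) * of_bool (\<sigma> (fst (e j)) = snd (e j)))
    \<le> real (card L - 1) / (real n * real (n - 1))"
proof -
  have e: "e j \<in> {1..n} \<times> {1..n}" if "j \<in> L" for j
    using assms that by (auto dest: bij_betwE)
  have ne: "e l \<noteq> e j" if "j \<in> L - {l}" for j
    using inj_onD[OF bij_betw_imp_inj_on[OF assms(1)], of l j] assms(2,3) that by blast
  have "inj_average {1..n} {1..n} (\<lambda>\<sigma>. of_bool (\<sigma> (fst (e l)) = snd (e l)) * of_bool (\<sigma> (fst (e j)) = snd (e j)))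
      \<le> 1 / (real n * real (n - 1))" if "j \<in> L - {l}" for j
    using inj_average_pair_le[of "{1..n}" "{1..n}" "fst (e l)" "fst (e j)" "snd (e l)" "snd (e j)"]
      e[of l] e[of j] ne[OF that] that assms(3) by (simp add: mem_Times_iff)
  from sum_mono[of "L - {l}", OF this] show ?thesis
    unfolding inj_average_sum using assms(2,3) finite_subset[OF assms(2)] by simp
qed

context normalized_sequence_space
begin

lemma perm_average_eq:
  "perm_average n N x = inj_average {1..n} {1..n} (\<lambda>\<sigma>. N (\<lambda>i. x i (\<sigma> i)))"
proof (rule perm_average_eq_inj_average[of n N x])
  fix a b :: "nat \<Rightarrow> real"
  assume "\<And>i. i \<in> {1..n} \<Longrightarrow> a i = b i"
  then show "N a = N b" by (rule coordinates[of a b])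
qed

text \<open>
  A quadratic in the number of large entries on the permutation bounds their maximum from below,
  so that only pair correlations are needed.
\<close>

lemma perm_average_ge_max:
  "perm_average n N x \<ge> 1 / (2 * real n) * (\<Sum>k=1..n. matrix_rearr n x k)"
proof -
  obtain e where e: "bij_betw e {1..n * n} ({1..n} \<times> {1..n})"
    "\<And>k. k \<in> {1..n * n} \<Longrightarrow> matrix_rearr n x k = \<bar>x (fst (e k)) (snd (e k))\<bar>"
    by (metis matrix_rearr_enumeration)
  define X where "X = matrix_rearr n x"
  have le: "k \<in> {1..n} \<Longrightarrow> k \<in> {1..n * n}" for k
    using dim_pos by (auto intro: order_trans[of k n "n * n"])
  then have X: "X k = \<bar>x (fst (e k)) (snd (e k))\<bar>" "e k \<in> {1..n} \<times> {1..n}" if "k \<in> {1..n}" for k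
    using that e bij_betwE[OF e(1)] by (auto simp: X_def)
  define h :: "nat \<Rightarrow> (nat \<Rightarrow> nat) \<Rightarrow> real"
    where "h l \<sigma> = of_bool (\<sigma> (fst (e l)) = snd (e l))" for l \<sigma>
  let ?avg = "inj_average {1..n} {1..n}"
  let ?Q = "\<lambda>\<sigma>. \<Sum>l=1..n. X l * (h l \<sigma> - 1 / 2 * (\<Sum>j\<in>{1..n} - {l}. h l \<sigma> * h j \<sigma>))"
  have "?Q \<sigma> \<le> N (\<lambda>i. x i (\<sigma> i))" for \<sigma>
  proof -
    let ?N = "N (\<lambda>i. x i (\<sigma> i))"
    define H where "H = {l \<in> {1..n}. \<sigma> (fst (e l)) = snd (e l)}"
    have fin: "finite H" by (simp add: H_def)
    have hit: "h l \<sigma> = of_bool (l \<in> H)" if "l \<in> {1..n}" for l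
      using that by (simp add: H_def h_def)
    have "X l * (h l \<sigma> - 1 / 2 * (\<Sum>j\<in>{1..n} - {l}. h l \<sigma> * h j \<sigma>)) =
        of_bool (l \<in> H) * (X l * (1 - (real (card H) - 1) / 2))" if "l \<in> {1..n}" for l
    proof (cases "l \<in> H")
      case True
      have "(\<Sum>j\<in>{1..n} - {l}. h j \<sigma>) = (\<Sum>j\<in>{1..n} - {l}. of_bool (j \<in> H))"
        by (intro sum.cong refl hit) auto
      also have "\<dots> = real (card (({1..n} - {l}) \<inter> H))"
        by (simp add: sum_of_bool_eq)
      also have "({1..n} - {l}) \<inter> H = H - {l}" by (auto simp: H_def)
      also have "real (card (H - {l})) = real (card H) - 1"
        using True fin card_gt_0_iff[of H] by (auto simp: of_nat_diff)
      finally show ?thesis using True that by (simp add: hit sum_distrib_left[symmetric])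
    qed (use that in \<open>simp add: hit\<close>)
    then have "?Q \<sigma> = (\<Sum>l\<in>{1..n}. of_bool (l \<in> H) * (X l * (1 - (real (card H) - 1) / 2)))"
      by (intro sum.cong) auto
    also have "\<dots> = (\<Sum>l\<in>H. X l * (1 - (real (card H) - 1) / 2))"
      by (intro sum.mono_neutral_cong_right) (auto simp: H_def)
    also have "\<dots> = (\<Sum>l\<in>H. X l) * ((3 - real (card H)) / 2)"
      unfolding sum_distrib_right by (intro sum.cong refl) (simp add: field_simps)
    also have "\<dots> \<le> ?N"
    proof -
      have bound: "X l \<le> ?N" "X l \<ge> 0" if "l \<in> H" for l
        using that X[of l] abs_coordinate_le[of "fst (e l)" "\<lambda>i. x i (\<sigma> i)"]
        by (simp_all add: H_def mem_Times_iff)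
      have sum: "(\<Sum>l\<in>H. X l) \<le> real (card H) * ?N" "(\<Sum>l\<in>H. X l) \<ge> 0"
        using sum_bounded_above[of H X ?N] bound by (auto intro: sum_nonneg)
      \<comment> \<open>As the sum over \<open>H\<close> is at most \<open>card H * ?N\<close>, what
        matters is that s (3 - s) / 2 \<le> 1 for every natural number s, with equality for s = 1
        and s = 2 and a nonpositive left side from 3 on.\<close>
      consider "card H = 0" | "card H = 1" | "card H = 2" | "card H \<ge> 3" by linarith
      then show ?thesis
      proof cases
        case 4
        then have "(\<Sum>l\<in>H. X l) * ((3 - real (card H)) / 2) \<le> 0"
          using sum(2) by (intro mult_nonneg_nonpos) auto
        then show ?thesis using nonneg[of "\<lambda>i. x i (\<sigma> i)"] by linarith
      qed (use sum fin nonneg in auto)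
    qed
    finally show ?thesis .
  qed
  then have "?avg ?Q \<le> perm_average n N x"
    unfolding perm_average_eq by (intro inj_average_mono)
  moreover have "?avg ?Q \<ge> (\<Sum>l=1..n. X l * (1 / (2 * real n)))"
  proof -
    have "?avg ?Q = (\<Sum>l=1..n. X l * (?avg (h l) - 1 / 2 * ?avg (\<lambda>\<sigma>. \<Sum>j\<in>{1..n} - {l}. h l \<sigma> * h j \<sigma>)))"
      by (simp only: inj_average_sum[of _ _ _ "{1..n}"] inj_average_mult inj_average_diff)
    also have "\<dots> \<ge> (\<Sum>l=1..n. X l * (1 / (2 * real n)))"
    proof (intro sum_mono mult_left_mono)
      fix l assume l: "l \<in> {1..n}"
      have "?avg (\<lambda>\<sigma>. \<Sum>j\<in>{1..n} - {l}. h l \<sigma> * h j \<sigma>) \<le> real (n - 1) / (real n * real (n - 1))"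
        using other_hits_average[OF e(1), of "{1..n}" l, folded h_def] l le by (simp add: subset_iff)
      \<comment> \<open>So each rank keeps the weight 1/n - 1/(2n) = 1/(2n). For
        \<open>n = 1\<close> the fraction is 0 by division by zero, as it should be: there are no
        other cells.\<close>
      also have "\<dots> \<le> 1 / real n"
        by (cases "n = 1") (simp_all add: field_simps)
      finally show "1 / (2 * real n) \<le> ?avg (h l) - 1 / 2 * ?avg (\<lambda>\<sigma>. \<Sum>j\<in>{1..n} - {l}. h l \<sigma> * h j \<sigma>)"
        using hit_average[OF X(2)[OF l]] unfolding h_def[symmetric] by (simp add: field_simps)
      show "X l \<ge> 0" using X(1)[OF l] by simp
    qed
    finally show ?thesis .
  qed
  ultimately show ?thesis
    by (simp add: X_def sum_divide_distrib)
qed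

text \<open>
  The number \<open>Z\<close> of \<open>k n\<close> given positions that lie on a random permutation has mean \<open>k\<close> and
  second moment at most \<open>3 k\<^sup>2\<close>, so it is at least \<open>k/2\<close> with probability at least \<open>1/12\<close>.
\<close>

lemma half_hits_probability:
  assumes e: "bij_betw e {1..n * n} ({1..n} \<times> {1..n})" and k: "k \<in> {1..n}"
  shows "1 / 12 \<le> inj_average {1..n} {1..n} (\<lambda>\<sigma>. of_bool
    (real k / 2 \<le> real (card {l \<in> {1..k * n}. \<sigma> (fst (e l)) = snd (e l)})))"
proof -
  let ?avg = "inj_average {1..n} {1..n}"
  define L where "L = {1..k * n}"
  define h :: "nat \<Rightarrow> (nat \<Rightarrow> nat) \<Rightarrow> real"
    where "h l \<sigma> = of_bool (\<sigma> (fst (e l)) = snd (e l))" for l \<sigma>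
  define Z where "Z \<sigma> = (\<Sum>l\<in>L. h l \<sigma>)" for \<sigma>
  have L: "L \<subseteq> {1..n * n}" "finite L" "card L = k * n"
    using k by (auto simp: L_def intro: order_trans[OF _ mult_le_mono1])
  have Z: "Z \<sigma> = real (card {l \<in> L. \<sigma> (fst (e l)) = snd (e l)})" for \<sigma>
    using L(2) by (simp add: Z_def h_def sum_of_bool_eq Int_def)
  have eL: "e l \<in> {1..n} \<times> {1..n}" if "l \<in> L" for l
    using that L(1) e by (auto dest: bij_betwE)
  have n: "real n > 0" and k1: "real k \<ge> 1" using k by auto
  have mean: "?avg Z = real k"
  proof -
    have "?avg Z = (\<Sum>l\<in>L. ?avg (h l))"
      unfolding Z_def by (rule inj_average_sum)
    also have "\<dots> = (\<Sum>l\<in>L. 1 / real n)"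
      unfolding h_def using eL by (intro sum.cong refl hit_average)
    also have "\<dots> = real k" using n L(3) by simp
    finally show ?thesis .
  qed
  have second: "?avg (\<lambda>\<sigma>. (Z \<sigma>)\<^sup>2) \<le> 3 * (real k)\<^sup>2"
  proof -
    have "(Z \<sigma>)\<^sup>2 = (\<Sum>l\<in>L. h l \<sigma> + (\<Sum>j\<in>L - {l}. h l \<sigma> * h j \<sigma>))" for \<sigma>
    proof -
      have "(Z \<sigma>)\<^sup>2 = (\<Sum>l\<in>L. \<Sum>j\<in>L. h l \<sigma> * h j \<sigma>)"
        by (simp add: Z_def power2_eq_square sum_product)
      also have "\<dots> = (\<Sum>l\<in>L. h l \<sigma> * h l \<sigma> + (\<Sum>j\<in>L - {l}. h l \<sigma> * h j \<sigma>))"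
        using L(2) by (intro sum.cong refl sum.remove) auto
      moreover have "h l \<sigma> * h l \<sigma> = h l \<sigma>" for l by (simp add: h_def)
      ultimately show ?thesis by simp
    qed
    then have "?avg (\<lambda>\<sigma>. (Z \<sigma>)\<^sup>2) = (\<Sum>l\<in>L. ?avg (h l) + ?avg (\<lambda>\<sigma>. \<Sum>j\<in>L - {l}. h l \<sigma> * h j \<sigma>))"
      by (simp only: inj_average_sum[of _ _ _ L] inj_average_add)
    also have "\<dots> \<le> (\<Sum>l\<in>L. 1 / real n + real (k * n - 1) / (real n * real (n - 1)))"
    proof (intro sum_mono add_mono)
      fix l assume l: "l \<in> L"
      show "?avg (h l) \<le> 1 / real n"
        using hit_average[OF eL[OF l]] unfolding h_def by simp
      show "?avg (\<lambda>\<sigma>. \<Sum>j\<in>L - {l}. h l \<sigma> * h j \<sigma>) \<le> real (k * n - 1) / (real n * real (n - 1))"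
        using other_hits_average[OF e L(1) l] L(3) unfolding h_def by simp
    qed
    also have "\<dots> = real k + real k * (real (k * n - 1) / real (n - 1))"
      using n L(3) by (simp add: distrib_left)
    \<comment> \<open>The diagonal contributes the mean \<open>k \<le> k * k\<close>. For the pairs,
      (kn - 1)/(n - 1) \<le> 2k when n \<ge> 2, because then kn \<ge> 2k.\<close>
    also have "\<dots> \<le> real k * real k + real k * (2 * real k)"
    proof (intro add_mono mult_left_mono)
      show "real k \<le> real k * real k" using k1 by simp
      show "real (k * n - 1) / real (n - 1) \<le> 2 * real k"
      proof (cases "n = 1")
        case False
        then have n2: "n \<ge> 2" using k by simp
        have "k * n \<ge> 2 * k" using n2 by simp
        then have "real (k * n) \<ge> 2 * real k" by (metis of_nat_le_iff of_nat_mult of_nat_numeral)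
        then have "real k * real n - 1 \<le> 2 * real k * (real n - 1)"
          by (simp add: algebra_simps)
        then show ?thesis
          using n2 k by (simp add: divide_le_eq of_nat_diff)
      qed simp
    qed simp
    finally show ?thesis by (simp add: power2_eq_square)
  qed
  have half: "?avg (\<lambda>\<sigma>. real k / 2) = real k / 2" by simp
  let ?P = "\<lambda>\<sigma>. of_bool (real k / 2 \<le> Z \<sigma>) :: real"
  \<comment> \<open>A quadratic form of the Paley-Zygmund argument. Where
    \<open>Z \<ge> k/2\<close>, the square of \<open>Z - 6k\<close> gives the bound 3k; elsewhere
    the left side is at most 0. On average the left side is at least k - k/2 - k/4 = k/4, whence the
    probability is at least 1/12.\<close>
  have "Z \<sigma> - real k / 2 - 1 / (12 * real k) * (Z \<sigma>)\<^sup>2 \<le> 3 * real k * ?P \<sigma>" for \<sigma>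
  proof (cases "real k / 2 \<le> Z \<sigma>")
    case True
    have "0 \<le> (Z \<sigma> - 6 * real k)\<^sup>2" by simp
    then have "12 * real k * Z \<sigma> - (Z \<sigma>)\<^sup>2 \<le> 36 * (real k)\<^sup>2"
      by (simp add: power2_eq_square algebra_simps)
    then have "Z \<sigma> - 1 / (12 * real k) * (Z \<sigma>)\<^sup>2 \<le> 3 * real k"
      using k1 by (simp add: field_simps power2_eq_square)
    then have "Z \<sigma> - real k / 2 - 1 / (12 * real k) * (Z \<sigma>)\<^sup>2 \<le> 3 * real k"
      using k1 by linarith
    then show ?thesis using True by simp
  next
    case False
    moreover have "0 \<le> 1 / (12 * real k) * (Z \<sigma>)\<^sup>2" by simp
    ultimately have "Z \<sigma> - real k / 2 - 1 / (12 * real k) * (Z \<sigma>)\<^sup>2 \<le> 0" by linarith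
    then show ?thesis by (simp only: False of_bool_eq mult_zero_right)
  qed
  then have "?avg (\<lambda>\<sigma>. Z \<sigma> - real k / 2 - 1 / (12 * real k) * (Z \<sigma>)\<^sup>2) \<le> ?avg (\<lambda>\<sigma>. 3 * real k * ?P \<sigma>)"
    by (intro inj_average_mono)
  then have "real k - real k / 2 - 1 / (12 * real k) * ?avg (\<lambda>\<sigma>. (Z \<sigma>)\<^sup>2) \<le> 3 * real k * ?avg ?P"
    by (simp only: inj_average_diff inj_average_mult mean half)
  moreover have "1 / (12 * real k) * ?avg (\<lambda>\<sigma>. (Z \<sigma>)\<^sup>2) \<le> 1 / (12 * real k) * (3 * (real k)\<^sup>2)"
    by (intro mult_left_mono second) simp
  moreover have "1 / (12 * real k) * (3 * (real k)\<^sup>2) = real k / 4"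
    using k1 by (simp add: power2_eq_square)
  ultimately have "real k * (1 / 4) \<le> real k * (3 * ?avg ?P)" by linarith
  then have "1 / 12 \<le> ?avg ?P"
    using k1 by (subst (asm) mult_le_cancel_left_pos) auto
  then show ?thesis by (simp add: Z L_def)
qed

text \<open>When at least k/2 of the \<open>k * n\<close> largest cells are hit, the entry of rank
  k/2, rounded up, on the permutation is at least \<open>matrix_rearr n x (k * n)\<close>. Averaging
  this coordinatewise loses 12, and the norm of an average is at most the average of the norms.
  Stretching the ranks by 2 loses another factor 2.\<close>

lemma perm_average_ge_dilated:
  "perm_average n N x \<ge> 1 / 24 * N (\<lambda>k. matrix_rearr n x (k * n))"
proof -
  obtain e where e: "bij_betw e {1..n * n} ({1..n} \<times> {1..n})"
    "\<And>k. k \<in> {1..n * n} \<Longrightarrow> matrix_rearr n x k = \<bar>x (fst (e k)) (snd (e k))\<bar>"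
    "\<And>k l. 1 \<le> k \<Longrightarrow> k \<le> l \<Longrightarrow> l \<le> n * n \<Longrightarrow> matrix_rearr n x l \<le> matrix_rearr n x k"
    by (metis matrix_rearr_enumeration)
  let ?avg = "inj_average {1..n} {1..n}"
  let ?v = "\<lambda>\<sigma> i. x i (\<sigma> i)"
  have "\<exists>\<tau>. bij_betw \<tau> {1..n} {1..n} \<and>
      (\<forall>k l. 1 \<le> k \<longrightarrow> k \<le> l \<longrightarrow> l \<le> n \<longrightarrow> \<bar>?v \<sigma> (\<tau> l)\<bar> \<le> \<bar>?v \<sigma> (\<tau> k)\<bar>)" for \<sigma>
    by (rule decreasing_enumeration[of "{1..n}" "\<lambda>i. \<bar>?v \<sigma> i\<bar>"]) auto
  then obtain \<tau> where \<tau>: "bij_betw (\<tau> \<sigma>) {1..n} {1..n}"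
    "\<And>k l. 1 \<le> k \<Longrightarrow> k \<le> l \<Longrightarrow> l \<le> n \<Longrightarrow> \<bar>?v \<sigma> (\<tau> \<sigma> l)\<bar> \<le> \<bar>?v \<sigma> (\<tau> \<sigma> k)\<bar>" for \<sigma>
    by metis
  define z where "z \<sigma> k = \<bar>?v \<sigma> (\<tau> \<sigma> k)\<bar>" for \<sigma> k
  have Nz: "N (z \<sigma>) \<le> N (?v \<sigma>)" for \<sigma>
  proof -
    have "N (z \<sigma>) = N (\<lambda>i. if i \<in> {1..n} then \<bar>?v \<sigma> (\<tau> \<sigma> i)\<bar> else 0)"
      by (intro coordinates) (simp add: z_def)
    also have "\<dots> \<le> N (\<lambda>i. \<bar>?v \<sigma> i\<bar>)"
      using \<tau>(1)[of \<sigma>] norm_reindex_le[of "{1..n}" "\<tau> \<sigma>" "\<lambda>i. \<bar>?v \<sigma> i\<bar>"]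
      by (simp add: bij_betw_def)
    finally show ?thesis by (simp add: norm_abs)
  qed
  have Nw: "N (\<lambda>k. z \<sigma> ((k + 1) div 2)) \<le> 2 * N (?v \<sigma>)" for \<sigma>
  proof -
    \<comment> \<open>\<open>(k + 1) div 2\<close> is k/2 rounded up; it takes each value at most
      once on odd and at most once on even \<open>k\<close>.\<close>
    have "N (\<lambda>k. z \<sigma> ((k + 1) div 2)) \<le> real 2 * N (z \<sigma>)"
    proof (rule norm_dilation_le[of 2 "\<lambda>k. (k + 1) div 2" "z \<sigma>"])
      have split: "2 * ((i + 1) div 2) = i + i mod 2" for i :: nat by presburger
      show "i = j" if "(i + 1) div 2 = (j + 1) div 2" "i mod 2 = j mod 2" for i j :: nat
        using split[of i] split[of j] that by linarith
      show "(i + 1) div 2 \<in> {1..n}" if "i \<in> {1..n}" for i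
        using that unfolding atLeastAtMost_iff by presburger
    qed simp
    with Nz[of \<sigma>] show ?thesis by simp
  qed
  have large: "matrix_rearr n x (k * n) \<le> z \<sigma> ((k + 1) div 2)"
    if k: "k \<in> {1..n}" and \<sigma>: "real k / 2 \<le> real (card {l \<in> {1..k * n}. \<sigma> (fst (e l)) = snd (e l)})" for k \<sigma>
  proof (rule ccontr)
    let ?H = "{l \<in> {1..k * n}. \<sigma> (fst (e l)) = snd (e l)}"
    let ?q = "(k + 1) div 2"
    assume less: "\<not> matrix_rearr n x (k * n) \<le> z \<sigma> ?q"
    have q: "1 \<le> ?q" "2 * ?q \<le> k + 1"
      using k unfolding atLeastAtMost_iff by presburger+
    have kn: "l \<in> {1..n * n}" if "l \<in> ?H" for l
      using that k by (auto intro: order_trans[OF _ mult_le_mono1])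
    have knn: "k * n \<le> n * n" using k by simp
    \<comment> \<open>Hit cells lie in distinct rows, and under the assumption \<open>less\<close>
      each such row has a rank before \<open>?q\<close> in the ordering
      \<open>\<tau> \<sigma>\<close>. So there are at most \<open>?q - 1\<close> hits, which is
      fewer than k/2.\<close>
    have "inj_on (\<lambda>l. fst (e l)) ?H"
    proof (rule inj_onI)
      fix l j assume "l \<in> ?H" "j \<in> ?H" "fst (e l) = fst (e j)"
      then have "e l = e j" by (auto simp: prod_eq_iff)
      then show "l = j"
        using inj_onD[OF bij_betw_imp_inj_on[OF e(1)]] kn \<open>l \<in> ?H\<close> \<open>j \<in> ?H\<close> by blast
    qed
    moreover have "(\<lambda>l. fst (e l)) ` ?H \<subseteq> \<tau> \<sigma> ` {1..<?q}"
    proof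
      fix i assume "i \<in> (\<lambda>l. fst (e l)) ` ?H"
      then obtain l where l: "l \<in> ?H" "i = fst (e l)" by blast
      have "e l \<in> {1..n} \<times> {1..n}" using bij_betwE[OF e(1)] kn[OF l(1)] by blast
      then have "i \<in> \<tau> \<sigma> ` {1..n}"
        using \<tau>(1)[of \<sigma>] l(2) by (simp add: bij_betw_def mem_Times_iff)
      then obtain j where j: "j \<in> {1..n}" "i = \<tau> \<sigma> j" by blast
      have "matrix_rearr n x (k * n) \<le> matrix_rearr n x l"
        using l(1) knn by (intro e(3)) auto
      also have "\<dots> = z \<sigma> j"
        using e(2)[OF kn[OF l(1)]] l j(2)[symmetric] by (simp add: z_def)
      finally have "z \<sigma> ?q < z \<sigma> j" using less by linarith
      with q have "\<not> ?q \<le> j"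
        using \<tau>(2)[of ?q j \<sigma>] j(1) unfolding z_def by (meson atLeastAtMost_iff not_le)
      then show "i \<in> \<tau> \<sigma> ` {1..<?q}" using j by auto
    qed
    ultimately have "card ?H \<le> card (\<tau> \<sigma> ` {1..<?q})"
      by (rule card_inj_on_le) simp
    also have "\<dots> \<le> ?q - 1" using card_image_le[of "{1..<?q}" "\<tau> \<sigma>"] by simp
    finally have "2 * card ?H < k" using q by linarith
    then have "real (2 * card ?H) < real k" by (simp only: of_nat_less_iff)
    then show False using \<sigma> by simp
  qed
  have "\<bar>1 / 12 * matrix_rearr n x (k * n)\<bar> \<le> \<bar>?avg (\<lambda>\<sigma>. z \<sigma> ((k + 1) div 2))\<bar>"
    if k: "k \<in> {1..n}" for k
  proof -
    let ?X = "matrix_rearr n x (k * n)"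
    let ?P = "\<lambda>\<sigma>. of_bool (real k / 2 \<le> real (card {l \<in> {1..k * n}. \<sigma> (fst (e l)) = snd (e l)})) :: real"
    have "k * n \<in> {1..n * n}" using k by auto
    then have X: "0 \<le> ?X" using e(2) by simp
    then have "?X * (1 / 12) \<le> ?X * ?avg ?P"
      by (intro mult_left_mono half_hits_probability[OF e(1) k])
    also have "\<dots> = ?avg (\<lambda>\<sigma>. ?X * ?P \<sigma>)" by (simp only: inj_average_mult)
    also have "\<dots> \<le> ?avg (\<lambda>\<sigma>. z \<sigma> ((k + 1) div 2))"
    proof (rule inj_average_mono)
      show "?X * ?P \<sigma> \<le> z \<sigma> ((k + 1) div 2)" for \<sigma>
        using large[OF k, of \<sigma>] by (simp add: z_def of_bool_def)
    qed
    finally show ?thesis using X by simp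
  qed
  then have "N (\<lambda>k. 1 / 12 * matrix_rearr n x (k * n)) \<le> N (\<lambda>k. ?avg (\<lambda>\<sigma>. z \<sigma> ((k + 1) div 2)))"
    by (rule monotone)
  then have "1 / 12 * N (\<lambda>k. matrix_rearr n x (k * n)) \<le> N (\<lambda>k. ?avg (\<lambda>\<sigma>. z \<sigma> ((k + 1) div 2)))"
    by (simp only: scale)
  also have "\<dots> \<le> ?avg (\<lambda>\<sigma>. N (\<lambda>k. z \<sigma> ((k + 1) div 2)))"
    by (rule norm_inj_average)
  also have "\<dots> \<le> ?avg (\<lambda>\<sigma>. 2 * N (?v \<sigma>))"
    by (intro inj_average_mono Nw)
  also have "\<dots> = 2 * perm_average n N x"
    by (simp only: perm_average_eq inj_average_mult)
  finally show ?thesis by simp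
qed

text \<open>Here 26 = 2 + 24: the two preceding bounds are cleared of their constants and
  added.\<close>

lemma lower_bound: "perm_average n N x \<ge> inverse 26 * rearr_bound n N x"
  using perm_average_ge_max[of x] perm_average_ge_dilated[of x]
  by (simp add: rearr_bound_def)

end

subsection \<open>Decreasing rearrangements of bounded functions\<close>

text \<open>Boundedness puts \<open>B\<close> into every set whose infimum is taken, also for
  \<open>s = 0\<close>, so the rearrangement is a genuine infimum with values in [0, B].\<close>

locale bounded_fun =
  fixes f :: "real \<Rightarrow> real" and B :: real
  assumes bounded: "\<And>u. \<bar>f u\<bar> \<le> B"
begin

lemma bound_mem: "s \<ge> 0 \<Longrightarrow> B \<in> {t. t \<ge> 0 \<and> measure lebesgue {u \<in> {0..1}. \<bar>f u\<bar> > t} \<le> s}"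
proof -
  have "{u \<in> {0..1}. \<bar>f u\<bar> > B} = {}"
    using bounded by (auto simp: not_less)
  moreover have "B \<ge> 0" using bounded[of 0] by linarith
  moreover assume "s \<ge> 0"
  ultimately show ?thesis by (simp only: mem_Collect_eq measure_empty)
qed

lemma decr_rearr_le:
  assumes "t \<ge> 0" "measure lebesgue {u \<in> {0..1}. \<bar>f u\<bar> > t} \<le> s"
  shows "decr_rearr f s \<le> t"
  unfolding decr_rearr_def using assms by (intro cInf_lower bdd_belowI[of _ 0]) auto

lemma decr_rearr_ge:
  assumes "s \<ge> 0" "\<And>t. t \<ge> 0 \<Longrightarrow> measure lebesgue {u \<in> {0..1}. \<bar>f u\<bar> > t} \<le> s \<Longrightarrow> c \<le> t"
  shows "c \<le> decr_rearr f s"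
  unfolding decr_rearr_def using bound_mem[OF assms(1)] assms(2) by (intro cInf_greatest) auto

lemma decr_rearr_nonneg: "s \<ge> 0 \<Longrightarrow> 0 \<le> decr_rearr f s"
  by (rule decr_rearr_ge)

lemma decr_rearr_le_bound: "s \<ge> 0 \<Longrightarrow> decr_rearr f s \<le> B"
  using bound_mem[of s] by (intro decr_rearr_le) auto

lemma decr_rearr_antimono: "0 \<le> s \<Longrightarrow> s \<le> s' \<Longrightarrow> decr_rearr f s' \<le> decr_rearr f s"
  by (rule decr_rearr_ge) (auto intro: decr_rearr_le)

lemma decr_rearr_integrable:
  assumes "0 \<le> a"
  shows "set_integrable lebesgue {a..b} (decr_rearr f)"
proof (rule set_integrable_bound)
  show "set_integrable lebesgue {a..b} (\<lambda>_. B)"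
    unfolding set_integrable_def
    by (intro integrable_scaleR_left integrable_real_indicator) (auto simp: emeasure_lborel_Icc_eq)
  \<comment> \<open>The rearrangement is controlled only for \<open>s \<ge> 0\<close>; composing
    with \<open>max 0\<close> gives a function monotone on the whole line, hence Borel, without
    changing it on \<open>{a..b}\<close>.\<close>
  have "mono (\<lambda>s. - decr_rearr f (max 0 s))"
    by (intro monoI) (auto intro!: decr_rearr_antimono)
  then have "(\<lambda>s. - decr_rearr f (max 0 s)) \<in> borel_measurable borel"
    by (rule borel_measurable_mono)
  then have "(\<lambda>s. - decr_rearr f (max 0 s)) \<in> borel_measurable lebesgue"
    by (intro measurable_completion) simp
  then have "(\<lambda>s. - (- decr_rearr f (max 0 s))) \<in> borel_measurable lebesgue"
    by (rule borel_measurable_uminus)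
  then have "(\<lambda>s. indicator {a..b} s *\<^sub>R decr_rearr f (max 0 s)) \<in> borel_measurable lebesgue"
    by (intro borel_measurable_scaleR borel_measurable_indicator) auto
  moreover have "(\<lambda>s. indicator {a..b} s *\<^sub>R decr_rearr f (max 0 s)) = (\<lambda>s. indicator {a..b} s *\<^sub>R decr_rearr f s)"
    using assms by (auto simp: indicator_def fun_eq_iff)
  ultimately show "set_borel_measurable lebesgue {a..b} (decr_rearr f)"
    by (simp add: set_borel_measurable_def)
  show "AE s in lebesgue. s \<in> {a..b} \<longrightarrow> norm (decr_rearr f s) \<le> norm B"
  proof (intro AE_I2 impI)
    fix s assume "s \<in> {a..b}"
    then have "0 \<le> s" using assms by simp
    from decr_rearr_nonneg[OF this] decr_rearr_le_bound[OF this]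
    show "norm (decr_rearr f s) \<le> norm B" by simp
  qed
qed

end

subsection \<open>Step functions\<close>

text \<open>The open cells and absolute values make this literally a concatenation of constant
  functions, so that facts about \<open>concat_fun\<close> apply to step functions and to their
  concatenations alike.\<close>

definition step_fun :: "nat \<Rightarrow> (nat \<Rightarrow> real) \<Rightarrow> real \<Rightarrow> real" where
  "step_fun n v u = (\<Sum>i=1..n. indicator {(real i - 1) / real n<..<real i / real n} u * \<bar>v i\<bar>)"

lemma cell_unique:
  assumes "u \<in> {(real i - 1) / real n<..<real i / real n}"
    and "u \<in> {(real j - 1) / real n<..<real j / real n}"
    and "n > 0"
  shows "i = j"
proof -
  have "real i - 1 < u * real n" "u * real n < real i" "real j - 1 < u * real n" "u * real n < real j"
    using assms by (auto simp: pos_less_divide_eq pos_divide_less_eq)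
  then have "real i < real j + 1" "real j < real i + 1" by linarith+
  then show ?thesis by linarith
qed

lemma indicator_cell:
  assumes "u \<in> {(real i - 1) / real n<..<real i / real n}" "n > 0"
  shows "indicator {(real j - 1) / real n<..<real j / real n} u = (of_bool (j = i) :: real)"
proof (cases "j = i")
  case True
  then show ?thesis using assms(1) by (simp add: indicator_def)
next
  case False
  then have "u \<notin> {(real j - 1) / real n<..<real j / real n}"
    using cell_unique[OF assms(1) _ assms(2)] by blast
  then show ?thesis using False by (simp add: indicator_def)
qed

lemma step_fun_cell:
  assumes "i \<in> {1..n}" "u \<in> {(real i - 1) / real n<..<real i / real n}"
  shows "step_fun n v u = \<bar>v i\<bar>"
proof -
  have "indicator {(real j - 1) / real n<..<real j / real n} u * \<bar>v j\<bar> = (if j = i then \<bar>v i\<bar> else 0)" for j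
    using assms by (subst indicator_cell[OF assms(2)]) auto
  then have "step_fun n v u = (\<Sum>j=1..n. if j = i then \<bar>v i\<bar> else 0)"
    unfolding step_fun_def by (intro sum.cong) auto
  then show ?thesis using assms(1) by simp
qed

lemma step_fun_eq_concat_fun: "step_fun n v = concat_fun n (\<lambda>k _. v k)"
  by (simp add: step_fun_def concat_fun_def fun_eq_iff)

lemma concat_fun_pos:
  assumes "concat_fun m x u > t" "t \<ge> 0"
  obtains k where "k \<in> {1..m}" "u \<in> {(real k - 1) / real m<..<real k / real m}"
    "\<bar>x k (real m * u - real k + 1)\<bar> > t"
proof -
  have "\<exists>k\<in>{1..m}. indicator {(real k - 1) / real m<..<real k / real m} u *
      \<bar>x k (real m * u - real k + 1)\<bar> \<noteq> (0::real)"
  proof (rule ccontr)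
    assume "\<not> ?thesis"
    then have "concat_fun m x u = 0"
      unfolding concat_fun_def by (intro sum.neutral) auto
    then show False using assms by simp
  qed
  then obtain k where k: "k \<in> {1..m}" "u \<in> {(real k - 1) / real m<..<real k / real m}"
    by (auto simp: indicator_def split: if_splits)
  have "indicator {(real j - 1) / real m<..<real j / real m} u * \<bar>x j (real m * u - real j + 1)\<bar> =
      (if j = k then \<bar>x k (real m * u - real k + 1)\<bar> else 0)" for j
    using k by (subst indicator_cell[OF k(2)]) auto
  then have "concat_fun m x u = (\<Sum>j=1..m. if j = k then \<bar>x k (real m * u - real k + 1)\<bar> else 0)"
    unfolding concat_fun_def by (intro sum.cong) auto
  then have "concat_fun m x u = \<bar>x k (real m * u - real k + 1)\<bar>" using k(1) by simp
  then show ?thesis using that k assms(1) by simp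
qed

lemma concat_fun_nonneg: "concat_fun m x u \<ge> 0"
  unfolding concat_fun_def by (intro sum_nonneg) auto

lemma concat_fun_bounded:
  assumes "\<And>k u. k \<in> {1..m} \<Longrightarrow> \<bar>x k u\<bar> \<le> b k"
  shows "\<bar>concat_fun m x u\<bar> \<le> (\<Sum>k=1..m. b k)"
proof -
  have "concat_fun m x u \<le> (\<Sum>k=1..m. b k)"
    unfolding concat_fun_def
  proof (rule sum_mono)
    fix k assume "k \<in> {1..m}"
    then have "\<bar>x k v\<bar> \<le> b k" for v by (rule assms)
    from this[of "real m * u - real k + 1"]
    show "indicator {(real k - 1) / real m<..<real k / real m} u * \<bar>x k (real m * u - real k + 1)\<bar> \<le> b k"
      by (auto simp: indicator_def)
  qed
  then show ?thesis using concat_fun_nonneg[of m x u] by simp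
qed

lemma step_fun_bounded: "\<bar>step_fun n v u\<bar> \<le> (\<Sum>i=1..n. \<bar>v i\<bar>)"
  unfolding step_fun_eq_concat_fun by (rule concat_fun_bounded) simp

lemma step_fun_measurable [measurable]: "step_fun n v \<in> borel_measurable borel"
  unfolding step_fun_def by measurable

lemma concat_fun_measurable:
  assumes "\<And>k. k \<in> {1..m} \<Longrightarrow> x k \<in> borel_measurable borel"
  shows "concat_fun m x \<in> borel_measurable borel"
  unfolding concat_fun_def
proof (intro borel_measurable_sum borel_measurable_times borel_measurable_abs)
  fix k assume "k \<in> {1..m}"
  then show "(\<lambda>u. x k (real m * u - real k + 1)) \<in> borel_measurable borel"
    by (intro measurable_compose[OF _ assms]) measurable
qed auto

lemma superlevel_measurable:
  fixes f :: "real \<Rightarrow> real"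
  assumes "f \<in> borel_measurable borel"
  shows "{u \<in> {0..1}. \<bar>f u\<bar> > t} \<in> sets lebesgue"
    and "{u \<in> {0..1}. \<bar>f u\<bar> > t} \<in> fmeasurable lebesgue"
proof -
  note [measurable] = assms
  have "{u \<in> space borel. u \<in> {0..1} \<and> \<bar>f u\<bar> > t} \<in> sets borel" by measurable
  then show *: "{u \<in> {0..1}. \<bar>f u\<bar> > t} \<in> sets lebesgue"
    by (simp add: sets_completionI_sets)
  show "{u \<in> {0..1}. \<bar>f u\<bar> > t} \<in> fmeasurable lebesgue"
    by (rule fmeasurableI2[OF _ _ *, of "{0..1}"]) auto
qed

lemma step_fun_carrier:
  assumes "n \<ge> 1"
  shows "step_fun n v \<in> ri_carrier n"
proof -
  interpret bounded_fun "step_fun n v" "\<Sum>i=1..n. \<bar>v i\<bar>"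
    by unfold_locales (rule step_fun_bounded)
  have "step_fun n v \<in> borel_measurable (lebesgue_on {0..1})"
    by (intro measurable_restrict_space1 measurable_completion) simp
  moreover have "set_integrable lebesgue {(real i - 1) / real n..real i / real n} (decr_rearr (step_fun n v))"
    if "i \<in> {1..n}" for i
    using that by (intro decr_rearr_integrable) auto
  ultimately show ?thesis by (simp add: ri_carrier_def)
qed

lemma superlevel_step_fun_ge:
  assumes "H \<subseteq> {1..n}" "\<And>i. i \<in> H \<Longrightarrow> \<bar>v i\<bar> > t"
  shows "real (card H) / real n \<le> measure lebesgue {u \<in> {0..1}. \<bar>step_fun n v u\<bar> > t}"
proof -
  let ?c = "\<lambda>i. {(real i - 1) / real n<..<real i / real n}"
  have fin: "finite H" using assms(1) finite_subset by blast
  have "pairwise (\<lambda>i j. disjnt (?c i) (?c j)) H"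
  proof (rule pairwiseI, unfold disjnt_iff, intro allI notI)
    fix i j u assume "i \<in> H" "j \<in> H" "i \<noteq> j" "u \<in> ?c i \<and> u \<in> ?c j"
    then show False using cell_unique[of u i n j] assms(1) by auto
  qed
  then have "measure lebesgue (\<Union>i\<in>H. ?c i) = (\<Sum>i\<in>H. measure lebesgue (?c i))"
    using fin by (intro measure_UNION') auto
  also have "\<dots> = (\<Sum>i\<in>H. 1 / real n)"
    by (intro sum.cong refl) (simp add: divide_right_mono diff_divide_distrib)
  finally have "measure lebesgue (\<Union>i\<in>H. ?c i) = real (card H) / real n" by simp
  moreover have "(\<Union>i\<in>H. ?c i) \<subseteq> {u \<in> {0..1}. \<bar>step_fun n v u\<bar> > t}"
  proof
    fix u assume "u \<in> (\<Union>i\<in>H. ?c i)"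
    then obtain i where i: "i \<in> H" "u \<in> ?c i" by blast
    then have i': "i \<in> {1..n}" using assms(1) by blast
    then have "0 \<le> (real i - 1) / real n" "real i / real n \<le> 1" by auto
    then have "u \<in> {0..1}" using i(2) by auto
    then show "u \<in> {u \<in> {0..1}. \<bar>step_fun n v u\<bar> > t}"
      using step_fun_cell[OF i' i(2)] assms(2)[OF i(1)] by simp
  qed
  moreover have "(\<Union>i\<in>H. ?c i) \<in> sets lebesgue" using fin by auto
  ultimately show ?thesis
    using measure_mono_fmeasurable[of "\<Union>i\<in>H. ?c i" "{u \<in> {0..1}. \<bar>step_fun n v u\<bar> > t}" lebesgue]
      superlevel_measurable(2)[OF step_fun_measurable] by simp
qed

text \<open>A point above the level lies in some block \<open>k\<close> and, after rescaling, in
  some cell \<open>i\<close> of that block, an interval of length 1/(mn). Subadditivity over these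
  intervals gives the bound.\<close>

lemma superlevel_concat_step_fun_le:
  assumes "m \<ge> 1" "n \<ge> 1" "t \<ge> 0"
  shows "measure lebesgue {u \<in> {0..1}. \<bar>concat_fun m (\<lambda>k. step_fun n (V k)) u\<bar> > t}
    \<le> real (\<Sum>k=1..m. card {i \<in> {1..n}. \<bar>V k i\<bar> > t}) / (real m * real n)"
proof -
  let ?C = "concat_fun m (\<lambda>k. step_fun n (V k))"
  let ?I = "Sigma {1..m} (\<lambda>k. {i \<in> {1..n}. \<bar>V k i\<bar> > t})"
  let ?F = "\<lambda>(k, i). {(real k - 1 + (real i - 1) / real n) / real m<..<(real k - 1 + real i / real n) / real m}"
  have fin: "finite ?I" by auto
  have "{u \<in> {0..1}. \<bar>?C u\<bar> > t} \<subseteq> (\<Union>p\<in>?I. ?F p)"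
  proof
    fix u assume "u \<in> {u \<in> {0..1}. \<bar>?C u\<bar> > t}"
    then have "?C u > t" using concat_fun_nonneg[of m "\<lambda>k. step_fun n (V k)" u] by simp
    then obtain k where k: "k \<in> {1..m}" "\<bar>step_fun n (V k) (real m * u - real k + 1)\<bar> > t"
      by (rule concat_fun_pos) (use assms in auto)
    let ?w = "real m * u - real k + 1"
    have "concat_fun n (\<lambda>i _. V k i) ?w > t"
      using k(2) concat_fun_nonneg[of n "\<lambda>i _. V k i" ?w] by (simp add: step_fun_eq_concat_fun)
    then obtain i where i: "i \<in> {1..n}" "?w \<in> {(real i - 1) / real n<..<real i / real n}" "\<bar>V k i\<bar> > t"
      by (rule concat_fun_pos) (use assms in auto)
    have "(real i - 1) / real n < ?w" "?w < real i / real n" using i(2) by auto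
    then have "real k - 1 + (real i - 1) / real n < u * real m" "u * real m < real k - 1 + real i / real n"
      by (simp_all only: mult.commute[of u])
    then have "u \<in> ?F (k, i)"
      using assms(1) by (simp add: pos_less_divide_eq pos_divide_less_eq)
    then show "u \<in> (\<Union>p\<in>?I. ?F p)" using k(1) i by blast
  qed
  then have "measure lebesgue {u \<in> {0..1}. \<bar>?C u\<bar> > t} \<le> measure lebesgue (\<Union>p\<in>?I. ?F p)"
  proof (rule measure_mono_fmeasurable)
    show "{u \<in> {0..1}. \<bar>?C u\<bar> > t} \<in> sets lebesgue"
      by (intro superlevel_measurable(1) concat_fun_measurable step_fun_measurable)
    show "(\<Union>p\<in>?I. ?F p) \<in> fmeasurable lebesgue"
      using fin by (intro fmeasurable.finite_UN) auto
  qed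
  also have "\<dots> \<le> (\<Sum>p\<in>?I. measure lebesgue (?F p))"
    using fin by (intro measure_UNION_le) auto
  also have "\<dots> = (\<Sum>p\<in>?I. 1 / (real m * real n))"
  proof (intro sum.cong refl)
    fix p assume "p \<in> ?I"
    then obtain k i where p: "p = (k, i)" "i \<in> {1..n}" by auto
    have "(real k - 1 + (real i - 1) / real n) / real m \<le> (real k - 1 + real i / real n) / real m"
      by (intro divide_right_mono add_left_mono) auto
    then have "measure lebesgue (?F p) =
        (real k - 1 + real i / real n) / real m - (real k - 1 + (real i - 1) / real n) / real m"
      by (simp add: p)
    also have "\<dots> = 1 / (real m * real n)"
      using assms by (simp add: field_simps)
    finally show "measure lebesgue (?F p) = 1 / (real m * real n)" .
  qed
  also have "\<dots> = real (card ?I) / (real m * real n)" by simp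
  also have "card ?I = (\<Sum>k=1..m. card {i \<in> {1..n}. \<bar>V k i\<bar> > t})"
    by (intro card_SigmaI) auto
  finally show ?thesis .
qed

section \<open>The r.i. norm of step functions, and the discrete form of the convexity
  condition\<close>

context symmetric_sequence_space
begin

text \<open>Below \<open>i / n\<close> the rearrangement is at least the \<open>i\<close>-th largest
  coordinate, since \<open>i\<close> cells exceed every smaller level. One factor
  \<open>1 / n\<close> is in the definition of the norm, the other is the length of a cell; the same
  square appears for concatenations and cancels later.\<close>

lemma ri_norm_step_fun_ge: "N v / (real n)\<^sup>2 \<le> ri_norm n N (step_fun n v)"
proof -
  interpret bounded_fun "step_fun n v" "\<Sum>i=1..n. \<bar>v i\<bar>"
    by unfold_locales (rule step_fun_bounded)
  have n: "real n > 0" using dim_pos by simp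
  obtain \<tau> where \<tau>: "bij_betw \<tau> {1..n} {1..n}"
    "\<And>k l. 1 \<le> k \<Longrightarrow> k \<le> l \<Longrightarrow> l \<le> n \<Longrightarrow> \<bar>v (\<tau> l)\<bar> \<le> \<bar>v (\<tau> k)\<bar>"
    by (rule decreasing_enumeration[of "{1..n}" "\<lambda>i. \<bar>v i\<bar>"]) auto
  let ?z = "\<lambda>i. \<bar>v (\<tau> i)\<bar>"
  have lower: "?z i \<le> decr_rearr (step_fun n v) s"
    if i: "i \<in> {1..n}" and s: "0 \<le> s" "s < real i / real n" for i s
  proof (rule decr_rearr_ge[OF s(1)], rule ccontr)
    fix t assume t: "measure lebesgue {u \<in> {0..1}. \<bar>step_fun n v u\<bar> > t} \<le> s" "\<not> ?z i \<le> t"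
    have "inj_on \<tau> {1..i}"
      using \<tau>(1) i by (auto simp: bij_betw_def intro: inj_on_subset)
    then have "card (\<tau> ` {1..i}) = i" by (simp add: card_image)
    moreover have "\<tau> ` {1..i} \<subseteq> {1..n}" using \<tau>(1) i by (auto simp: bij_betw_def)
    moreover have "\<bar>v j\<bar> > t" if "j \<in> \<tau> ` {1..i}" for j
      using that \<tau>(2)[of _ i] t(2) i by fastforce
    ultimately have "real i / real n \<le> measure lebesgue {u \<in> {0..1}. \<bar>step_fun n v u\<bar> > t}"
      using superlevel_step_fun_ge[of "\<tau> ` {1..i}" n t v] by simp
    then show False using t(1) s(2) by simp
  qed
  have int: "1 / real n * ?z i \<le> (LINT s:{(real i - 1) / real n..real i / real n}|lebesgue. decr_rearr (step_fun n v) s)"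
    if i: "i \<in> {1..n}" for i
  proof -
    let ?a = "(real i - 1) / real n" and ?b = "real i / real n"
    have a: "0 \<le> ?a" using i by simp
    have ab: "?a \<le> ?b" by (intro divide_right_mono) auto
    have "1 / real n * ?z i = (?b - ?a) * ?z i" by (simp add: diff_divide_distrib)
    \<comment> \<open>The cell is half-open because \<open>lower\<close> needs
      \<open>s < ?b\<close>; at the endpoint nonnegativity of the rearrangement suffices.\<close>
    also have "\<dots> = (LINT s|lebesgue. indicator {?a..<?b} s *\<^sub>R ?z i)"
      using ab by simp
    also have "\<dots> \<le> (LINT s|lebesgue. indicator {?a..?b} s *\<^sub>R decr_rearr (step_fun n v) s)"
    proof (rule integral_mono)
      show "integrable lebesgue (\<lambda>s. indicator {?a..<?b} s *\<^sub>R ?z i)"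
        by (intro integrable_scaleR_left integrable_real_indicator) (auto simp: emeasure_lborel_Ico[OF ab])
      show "integrable lebesgue (\<lambda>s. indicator {?a..?b} s *\<^sub>R decr_rearr (step_fun n v) s)"
        using decr_rearr_integrable[OF a] by (simp add: set_integrable_def)
      show "indicator {?a..<?b} s *\<^sub>R ?z i \<le> indicator {?a..?b} s *\<^sub>R decr_rearr (step_fun n v) s" for s
        using lower[OF i, of s] a decr_rearr_nonneg[of s] by (auto simp: indicator_def)
    qed
    finally show ?thesis by (simp add: set_lebesgue_integral_def)
  qed
  have "N v / (real n)\<^sup>2 = \<bar>1 / real n * (1 / real n)\<bar> * N ?z"
    using norm_bij[OF \<tau>(1), of "\<lambda>i. \<bar>v i\<bar>"] by (simp add: norm_abs power2_eq_square)
  also have "\<dots> = N (\<lambda>i. 1 / real n * (1 / real n) * ?z i)" by (simp only: scale)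
  also have "\<dots> \<le> ri_norm n N (step_fun n v)"
    unfolding ri_norm_def
  proof (rule monotone)
    fix i assume "i \<in> {1..n}"
    from mult_left_mono[OF int[OF this], of "1 / real n"]
    have "1 / real n * (1 / real n) * ?z i \<le>
      1 / real n * (LINT s:{(real i - 1) / real n..real i / real n}|lebesgue. decr_rearr (step_fun n v) s)"
      by (simp add: mult.assoc)
    moreover have "0 \<le> 1 / real n * (1 / real n) * ?z i" by simp
    ultimately show "\<bar>1 / real n * (1 / real n) * ?z i\<bar> \<le>
      \<bar>1 / real n * (LINT s:{(real i - 1) / real n..real i / real n}|lebesgue. decr_rearr (step_fun n v) s)\<bar>"
      by linarith
  qed
  finally show ?thesis .
qed

text \<open>The counting hypothesis bounds the measure of the set above level \<open>b i\<close> by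
  \<open>(i - 1) / n\<close>, the left end of the \<open>i\<close>-th interval, so the rearrangement
  is at most \<open>b i\<close> on all of that interval.\<close>

lemma ri_norm_concat_step_fun_le:
  assumes "m \<ge> 1"
    and "\<And>i. i \<in> {1..n} \<Longrightarrow> b i \<ge> 0"
    and "\<And>i. i \<in> {1..n} \<Longrightarrow> (\<Sum>k=1..m. card {j \<in> {1..n}. \<bar>V k j\<bar> > b i}) \<le> m * (i - 1)"
  shows "ri_norm n N (concat_fun m (\<lambda>k. step_fun n (V k))) \<le> N b / (real n)\<^sup>2"
proof -
  let ?C = "concat_fun m (\<lambda>k. step_fun n (V k))"
  interpret bounded_fun ?C "\<Sum>k=1..m. \<Sum>i=1..n. \<bar>V k i\<bar>"
    by unfold_locales (intro concat_fun_bounded step_fun_bounded)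
  have n: "real n > 0" using dim_pos by simp
  have "ri_norm n N ?C \<le> N (\<lambda>i. 1 / real n * (1 / real n) * b i)"
    unfolding ri_norm_def
  proof (rule monotone)
    fix i assume i: "i \<in> {1..n}"
    let ?a = "(real i - 1) / real n" and ?b = "real i / real n"
    let ?int = "LINT s:{?a..?b}|lebesgue. decr_rearr ?C s"
    have a: "0 \<le> ?a" using i by simp
    have ab: "?a \<le> ?b" by (intro divide_right_mono) auto
    have upper: "decr_rearr ?C s \<le> b i" if "?a \<le> s" for s
    proof (rule decr_rearr_le)
      show "b i \<ge> 0" using i by (rule assms(2))
      have "measure lebesgue {u \<in> {0..1}. \<bar>?C u\<bar> > b i}
          \<le> real (\<Sum>k=1..m. card {j \<in> {1..n}. \<bar>V k j\<bar> > b i}) / (real m * real n)"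
        using assms(1) dim_pos assms(2)[OF i] by (rule superlevel_concat_step_fun_le)
      also have "\<dots> \<le> real (m * (i - 1)) / (real m * real n)"
        using assms(3)[OF i] by (intro divide_right_mono) (simp_all only: of_nat_le_iff, simp)
      also have "\<dots> = ?a" using assms(1) i by (simp add: of_nat_diff)
      finally show "measure lebesgue {u \<in> {0..1}. \<bar>?C u\<bar> > b i} \<le> s" using that by simp
    qed
    have "?int \<le> (LINT s|lebesgue. indicator {?a..?b} s *\<^sub>R b i)"
      unfolding set_lebesgue_integral_def
    proof (rule integral_mono')
      show "integrable lebesgue (\<lambda>s. indicator {?a..?b} s *\<^sub>R b i)"
        by (intro integrable_scaleR_left integrable_real_indicator) (auto simp: emeasure_lborel_Icc_eq)
    qed (use upper assms(2)[OF i] in \<open>auto simp: indicator_def\<close>)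
    also have "\<dots> = 1 / real n * b i"
      using ab by (simp add: diff_divide_distrib)
    finally have "?int \<le> 1 / real n * b i" .
    moreover have "0 \<le> ?int"
      unfolding set_lebesgue_integral_def
      using a decr_rearr_nonneg by (intro integral_nonneg_AE AE_I2) (auto simp: indicator_def)
    ultimately show "\<bar>1 / real n * ?int\<bar> \<le> \<bar>1 / real n * (1 / real n) * b i\<bar>"
      using n assms(2)[OF i] mult_left_mono[of ?int "1 / real n * b i" "1 / real n"]
      by (simp add: mult.assoc)
  qed
  also have "\<dots> = \<bar>1 / real n * (1 / real n)\<bar> * N b" by (rule scale)
  finally show ?thesis by (simp add: power2_eq_square)
qed

text \<open>
  \<open>D\<^sup>*\<close>-convexity in combinatorial form: the hypothesis says that the decreasing rearrangement of
  the concatenation of the vectors \<open>V k\<close>, viewed as step functions, is dominated by \<open>b\<close>.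
\<close>

lemma Dstar_convex_vectors:
  assumes D: "Dstar_convex_with K (ri_carrier n) (ri_norm n N)" and K: "K > 0" and m: "m \<ge> 1"
    and b: "\<And>i. i \<in> {1..n} \<Longrightarrow> b i \<ge> 0"
      "\<And>i. i \<in> {1..n} \<Longrightarrow> (\<Sum>k=1..m. card {j \<in> {1..n}. \<bar>V k j\<bar> > b i}) \<le> m * (i - 1)"
  obtains k where "k \<in> {1..m}" "N (V k) \<le> K * N b"
proof -
  let ?r = "\<lambda>k. ri_norm n N (step_fun n (V k))"
  \<comment> \<open>A finite infimum is attained, which yields one vector of small norm.\<close>
  have "(INF k\<in>{1..m}. ?r k) \<in> ?r ` {1..m}"
    using m by (subst cInf_eq_Min) (auto intro!: Min_in)
  then obtain k where k: "k \<in> {1..m}" "(INF k\<in>{1..m}. ?r k) = ?r k" by blast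
  have "inverse K * ?r k \<le> ri_norm n N (concat_fun m (\<lambda>k. step_fun n (V k)))"
    using D[unfolded Dstar_convex_with_def, rule_format, of m "\<lambda>k. step_fun n (V k)"] m
      step_fun_carrier[OF dim_pos] by (simp only: k(2))
  also have "\<dots> \<le> N b / (real n)\<^sup>2"
    using m b by (rule ri_norm_concat_step_fun_le)
  finally have "?r k \<le> K * (N b / (real n)\<^sup>2)"
    using K by (simp add: field_simps)
  then have "N (V k) / (real n)\<^sup>2 \<le> K * N b / (real n)\<^sup>2"
    using ri_norm_step_fun_ge[of "V k"] by simp
  then have "N (V k) \<le> K * N b"
    using dim_pos by (subst (asm) divide_le_cancel) auto
  then show ?thesis using that k(1) by blast
qed

end

subsection \<open>The upper bound\<close>

context normalized_sequence_space
begin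

text \<open>
  A Hoffmann--Joergensen argument: reveal the values of the injection row by row and stop as soon
  as the norm exceeds \<open>t\<close>. At that moment it is at most \<open>t + a\<close>, and the contribution of the
  remaining rows is controlled by induction. The side condition on the cardinalities survives the
  removal of a row and a column.
\<close>

lemma stopped_average_le:
  assumes t: "t \<ge> 0"
    and w: "\<And>i j. i \<in> {1..n} \<Longrightarrow> j \<in> {1..n} \<Longrightarrow> \<bar>w i j\<bar> \<le> a"
    and half: "\<And>I J. I \<subseteq> {1..n} \<Longrightarrow> J \<subseteq> {1..n} \<Longrightarrow> n + 2 * card I \<le> 2 * card J + 1 \<Longrightarrow>
      inj_average I J (\<lambda>\<sigma>. of_bool (t < N (\<lambda>i. if i \<in> I then w i (\<sigma> i) else 0))) \<le> 1 / 2"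
    and "I \<subseteq> {1..n}" "J \<subseteq> {1..n}" "n + 2 * card I \<le> 2 * card J + 1"
    and "N u \<le> t" "\<And>i. i \<in> I \<Longrightarrow> u i = 0"
  shows "inj_average I J (\<lambda>\<sigma>. N (\<lambda>i. if i \<in> I then w i (\<sigma> i) else u i)) \<le>
    t + a + 2 * (t + a) * inj_average I J (\<lambda>\<sigma>. of_bool (t < N (\<lambda>i. if i \<in> I then w i (\<sigma> i) else u i)))"
proof -
  have a: "a \<ge> 0" using w[of 1 1] dim_pos by simp
  have "finite I" using assms(4) finite_subset by blast
  then show ?thesis
    using assms(4-)
  proof (induction I arbitrary: J u)
    case empty
    then show ?case using t a by (simp add: add_nonneg_nonneg mult_nonneg_nonneg)
  next
    case (insert r I)
    let ?T = "t + a"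
    let ?mix = "\<lambda>I u \<sigma> i. if i \<in> I then w i (\<sigma> i) else u i"
    have finJ: "finite J" using insert.prems finite_subset by blast
    have r: "r \<in> {1..n}" and I: "I \<subseteq> {1..n}" using insert.prems by auto
    have less: "card I < card J" using insert.prems insert.hyps dim_pos by simp
    have step: "inj_average I (J - {c}) (\<lambda>\<sigma>. N (?mix (insert r I) u (\<sigma>(r := c)))) \<le>
        ?T + 2 * ?T * inj_average I (J - {c}) (\<lambda>\<sigma>. of_bool (t < N (?mix (insert r I) u (\<sigma>(r := c)))))"
      if c: "c \<in> J" for c
    proof -
      let ?J = "J - {c}" and ?u = "u(r := w r c)"
      let ?avg = "inj_average I ?J"
      have mix: "?mix (insert r I) u (\<sigma>(r := c)) = ?mix I ?u \<sigma>" for \<sigma> :: "nat \<Rightarrow> nat"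
        using insert.hyps by (auto simp: fun_eq_iff)
      have J: "?J \<subseteq> {1..n}" using insert.prems by auto
      have cardJ: "card ?J = card J - 1" using c finJ by simp
      \<comment> \<open>Both sides of the condition drop by 2.\<close>
      then have side: "n + 2 * card I \<le> 2 * card ?J + 1"
        using insert.prems(3) insert.hyps less by simp
      have u0: "?u i = 0" if "i \<in> I" for i
        using that insert.prems(5) insert.hyps by auto
      show ?thesis
      proof (cases "N ?u \<le> t")
        case True
        show ?thesis unfolding mix
          using I J side True u0 by (rule insert.IH)
      next
        case False
        have "N ?u = N (\<lambda>i. u i + (if i = r then w r c else 0))"
          using insert.prems(5)[of r] by (intro coordinates) simp
        also have "\<dots> \<le> N u + \<bar>w r c\<bar>"
          using triangle[of u "\<lambda>i. if i = r then w r c else 0"] norm_single[OF r] by simp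
        also have "\<dots> \<le> ?T"
          using insert.prems(4) w[OF r, of c] c insert.prems(2) by auto
        finally have uT: "N ?u \<le> ?T" .
        have "?avg (\<lambda>\<sigma>. N (?mix I ?u \<sigma>)) \<le> ?avg (\<lambda>\<sigma>. ?T + N (?mix I (\<lambda>_. 0) \<sigma>))"
        proof (rule inj_average_mono)
          fix \<sigma>
          have "N (?mix I ?u \<sigma>) = N (\<lambda>i. ?u i + ?mix I (\<lambda>_. 0) \<sigma> i)"
            using u0 by (intro coordinates) simp
          also have "\<dots> \<le> N ?u + N (?mix I (\<lambda>_. 0) \<sigma>)" by (rule triangle)
          finally show "N (?mix I ?u \<sigma>) \<le> ?T + N (?mix I (\<lambda>_. 0) \<sigma>)" using uT by linarith
        qed
        also have "\<dots> = ?T + ?avg (\<lambda>\<sigma>. N (?mix I (\<lambda>_. 0) \<sigma>))"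
          using insert.hyps finJ less cardJ by (simp add: inj_average_add)
        also have "?avg (\<lambda>\<sigma>. N (?mix I (\<lambda>_. 0) \<sigma>)) \<le>
            ?T + 2 * ?T * ?avg (\<lambda>\<sigma>. of_bool (t < N (?mix I (\<lambda>_. 0) \<sigma>)))"
          using I J side by (rule insert.IH) (use t in auto)
        also have "\<dots> \<le> ?T + 2 * ?T * (1 / 2)"
          using t a by (intro add_left_mono mult_left_mono half I J side) auto
        finally have "?avg (\<lambda>\<sigma>. N (?mix I ?u \<sigma>)) \<le> ?T + 2 * ?T * 1" by (simp add: field_simps)
        \<comment> \<open>The revealed part costs at most \<open>?T\<close>, the remaining rows
          restarted from 0 cost at most \<open>?T + 2 * ?T * (1 / 2)\<close>. The total 3
          \<open>?T\<close> fits the claim because the event is now certain: further rows can only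
          increase the norm.\<close>
        also have "1 = ?avg (\<lambda>\<sigma>. of_bool (t < N (?mix I ?u \<sigma>)))"
        proof -
          have "t < N (?mix I ?u \<sigma>)" for \<sigma>
          proof -
            have "N ?u \<le> N (?mix I ?u \<sigma>)"
              using u0 by (intro monotone) auto
            then show ?thesis using False by linarith
          qed
          then show ?thesis using insert.hyps finJ less cardJ by simp
        qed
        finally show ?thesis unfolding mix .
      qed
    qed
    have "inj_average (insert r I) J (\<lambda>\<sigma>. N (?mix (insert r I) u \<sigma>)) =
        (\<Sum>c\<in>J. inj_average I (J - {c}) (\<lambda>\<sigma>. N (?mix (insert r I) u (\<sigma>(r := c))))) / real (card J)"
      using insert.hyps finJ less by (subst inj_average_insert) auto
    also have "\<dots> \<le> (\<Sum>c\<in>J. ?T + 2 * ?T * inj_average I (J - {c})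
        (\<lambda>\<sigma>. of_bool (t < N (?mix (insert r I) u (\<sigma>(r := c)))))) / real (card J)"
      by (intro divide_right_mono sum_mono step) auto
    also have "\<dots> = ?T + 2 * ?T * ((\<Sum>c\<in>J. inj_average I (J - {c})
        (\<lambda>\<sigma>. of_bool (t < N (?mix (insert r I) u (\<sigma>(r := c)))))) / real (card J))"
      using less by (simp add: sum.distrib sum_distrib_left[symmetric] add_divide_distrib)
    also have "(\<Sum>c\<in>J. inj_average I (J - {c})
        (\<lambda>\<sigma>. of_bool (t < N (?mix (insert r I) u (\<sigma>(r := c)))))) / real (card J) =
        inj_average (insert r I) J (\<lambda>\<sigma>. of_bool (t < N (?mix (insert r I) u \<sigma>)))"
      using insert.hyps finJ less by (subst inj_average_insert) auto
    finally show ?case .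
  qed
qed

text \<open>The stopping bound started at 0, with event probability at most 1/2, doubles
  \<open>t + a\<close>. With all columns available, the side condition allows up to (n + 1)/2
  rows.\<close>

lemma average_le_of_half:
  assumes t: "t \<ge> 0"
    and w: "\<And>i j. i \<in> {1..n} \<Longrightarrow> j \<in> {1..n} \<Longrightarrow> \<bar>w i j\<bar> \<le> a"
    and half: "\<And>I J. I \<subseteq> {1..n} \<Longrightarrow> J \<subseteq> {1..n} \<Longrightarrow> n + 2 * card I \<le> 2 * card J + 1 \<Longrightarrow>
      inj_average I J (\<lambda>\<sigma>. of_bool (t < N (\<lambda>i. if i \<in> I then w i (\<sigma> i) else 0))) \<le> 1 / 2"
    and I: "I \<subseteq> {1..n}" "n + 2 * card I \<le> 2 * n + 1"
  shows "inj_average {1..n} {1..n} (\<lambda>\<sigma>. N (\<lambda>i. if i \<in> I then w i (\<sigma> i) else 0)) \<le> 2 * (t + a)"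
proof -
  let ?F = "\<lambda>\<sigma>. N (\<lambda>i. if i \<in> I then w i (\<sigma> i) else 0)"
  have a: "a \<ge> 0" using w[of 1 1] dim_pos by simp
  have "inj_average {1..n} {1..n} (\<lambda>\<sigma>. ?F (restrict \<sigma> I)) = inj_average I {1..n} ?F"
    using I by (intro inj_average_restrict) auto
  moreover have "?F (restrict \<sigma> I) = ?F \<sigma>" for \<sigma>
    by (intro coordinates) simp
  ultimately have "inj_average {1..n} {1..n} ?F = inj_average I {1..n} ?F" by simp
  also have "\<dots> \<le> t + a + 2 * (t + a) * inj_average I {1..n} (\<lambda>\<sigma>. of_bool (t < ?F \<sigma>))"
    using t w half I by (intro stopped_average_le[where u = "\<lambda>_. 0"]) auto
  also have "\<dots> \<le> t + a + 2 * (t + a) * (1 / 2)"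
    using t a I by (intro add_left_mono mult_left_mono half) auto
  finally show ?thesis by (simp add: field_simps)
qed

text \<open>
  If the norm along more than half of the injections exceeded \<open>t\<close>, then so would, up to the
  factor \<open>K\<close>, the norm of the concatenation of the corresponding vectors, whose distribution
  function is at most four times that of the whole matrix.
\<close>

lemma half_of_Dstar_convex:
  assumes D: "Dstar_convex_with K (ri_carrier n) (ri_norm n N)" and K: "K > 0"
    and y: "\<And>q. q \<in> {1..n} \<Longrightarrow> y q \<ge> 0"
    and large: "\<And>q. q \<in> {1..n} \<Longrightarrow>
      card {(r, c) \<in> {1..n} \<times> {1..n}. \<bar>w r c\<bar> > y q} \<le> (q - 1) * n"
    and I: "I \<subseteq> {1..n}" and J: "J \<subseteq> {1..n}" and side: "n + 2 * card I \<le> 2 * card J + 1"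
  shows "inj_average I J (\<lambda>\<sigma>. of_bool (4 * K * N y < N (\<lambda>i. if i \<in> I then w i (\<sigma> i) else 0))) \<le> 1 / 2"
proof (cases "I = {}")
  case True
  then show ?thesis using K nonneg[of y] by (simp add: not_less)
next
  case False
  let ?t = "4 * K * N y"
  let ?v = "\<lambda>\<sigma> i. if i \<in> I then w i (\<sigma> i) else 0"
  let ?S = "{\<sigma> \<in> injections I J. ?t < N (?v \<sigma>)}"
  have fin: "finite I" "finite J" using I J finite_subset by blast+
  then have card_I: "card I \<ge> 1" using False by (simp add: Suc_leI card_gt_0_iff)
  \<comment> \<open>For nonempty \<open>I\<close> the side condition leaves at least half of the
    columns in \<open>J\<close>.\<close>
  have IJ: "card I \<le> card J" "n \<le> 2 * card J" using side card_I dim_pos by auto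
  then have cJ: "real (card J) > 0" using dim_pos by simp
  have fin_inj: "finite (injections I J)" using fin by simp
  show ?thesis
  proof (rule ccontr)
    assume "\<not> ?thesis"
    moreover have "inj_average I J (\<lambda>\<sigma>. of_bool (?t < N (?v \<sigma>))) = real (card ?S) / real (card (injections I J))"
      using fin_inj by (simp add: inj_average_def Int_def)
    ultimately have "1 / 2 < real (card ?S) / real (card (injections I J))" by linarith
    then have S: "real (card (injections I J)) < 2 * real (card ?S)"
      using card_injections_pos[OF fin IJ(1)] by (subst (asm) pos_less_divide_eq) auto
    define m where "m = card ?S"
    have m: "m \<ge> 1" using S by (simp add: m_def Suc_leI)
    obtain g where g: "bij_betw g {1..m} ?S"
      using ex_bij_betw_nat_finite_1[of ?S] fin_inj unfolding m_def by auto
    \<comment> \<open>This is i/4 rounded up. The 4 is a product of two factors 2: \<open>?S\<close>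
      holds more than half of the injections, and \<open>J\<close> at least half of the
      columns.\<close>
    define \<phi> where "\<phi> i = (i - 1) div 4 + 1" for i :: nat
    have \<phi>: "\<phi> i \<in> {1..n}" if "i \<in> {1..n}" for i
      using that unfolding \<phi>_def atLeastAtMost_iff by presburger
    have count: "(\<Sum>k=1..m. card {j \<in> {1..n}. \<bar>?v (g k) j\<bar> > y (\<phi> i)}) \<le> m * (i - 1)"
      if i: "i \<in> {1..n}" for i
    proof -
      let ?b = "y (\<phi> i)"
      have b: "?b \<ge> 0" using y \<phi>[OF i] by blast
      have card_v: "real (card {j \<in> {1..n}. \<bar>?v \<sigma> j\<bar> > ?b}) = (\<Sum>r\<in>I. of_bool (\<bar>w r (\<sigma> r)\<bar> > ?b))" for \<sigma>
      proof -
        have "{j \<in> {1..n}. \<bar>?v \<sigma> j\<bar> > ?b} = I \<inter> {r. \<bar>w r (\<sigma> r)\<bar> > ?b}"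
          using I b by (auto split: if_splits)
        then show ?thesis using fin by (simp add: Int_def)
      qed
      have "real (\<Sum>k=1..m. card {j \<in> {1..n}. \<bar>?v (g k) j\<bar> > ?b}) =
          (\<Sum>\<sigma>\<in>?S. real (card {j \<in> {1..n}. \<bar>?v \<sigma> j\<bar> > ?b}))"
        using sum.reindex_bij_betw[OF g, of "\<lambda>\<sigma>. real (card {j \<in> {1..n}. \<bar>?v \<sigma> j\<bar> > ?b})"] by simp
      \<comment> \<open>Passing from \<open>?S\<close> to all injections makes the value in each row
        uniform on \<open>J\<close>, so that large coordinates can be counted by large cells of the
        matrix.\<close>
      also have "\<dots> \<le> (\<Sum>\<sigma>\<in>injections I J. real (card {j \<in> {1..n}. \<bar>?v \<sigma> j\<bar> > ?b}))"
        using fin_inj by (intro sum_mono2) auto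
      also have "\<dots> = real (card (injections I J)) * inj_average I J (\<lambda>\<sigma>. \<Sum>r\<in>I. of_bool (\<bar>w r (\<sigma> r)\<bar> > ?b))"
        using card_injections_pos[OF fin IJ(1)] by (simp only: card_v inj_average_def) simp
      also have "inj_average I J (\<lambda>\<sigma>. \<Sum>r\<in>I. of_bool (\<bar>w r (\<sigma> r)\<bar> > ?b)) =
          (\<Sum>r\<in>I. (\<Sum>c\<in>J. of_bool (\<bar>w r c\<bar> > ?b)) / real (card J))"
        unfolding inj_average_sum
        using fin IJ by (intro sum.cong refl inj_average_marginal[where g = "\<lambda>c. of_bool (\<bar>w _ c\<bar> > ?b)"]) auto
      also have "\<dots> = (\<Sum>(r, c)\<in>I \<times> J. of_bool (\<bar>w r c\<bar> > ?b)) / real (card J)"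
        by (simp only: sum_divide_distrib[symmetric] sum.cartesian_product)
      also have "(\<Sum>(r, c)\<in>I \<times> J. of_bool (\<bar>w r c\<bar> > ?b)) = real (card {(r, c) \<in> I \<times> J. \<bar>w r c\<bar> > ?b})"
        using fin by (simp add: case_prod_unfold Int_def mem_Times_iff)
      also have "real (card (injections I J)) * (real (card {(r, c) \<in> I \<times> J. \<bar>w r c\<bar> > ?b}) / real (card J))
          \<le> (2 * real m) * (real ((\<phi> i - 1) * n) / real (card J))"
      proof (intro mult_mono divide_right_mono)
        have "card {(r, c) \<in> I \<times> J. \<bar>w r c\<bar> > ?b} \<le> card {(r, c) \<in> {1..n} \<times> {1..n}. \<bar>w r c\<bar> > ?b}"
        proof (rule card_mono)
          show "finite {(r, c) \<in> {1..n} \<times> {1..n}. \<bar>w r c\<bar> > ?b}"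
            by (rule finite_subset[of _ "{1..n} \<times> {1..n}"]) auto
          show "{(r, c) \<in> I \<times> J. \<bar>w r c\<bar> > ?b} \<subseteq> {(r, c) \<in> {1..n} \<times> {1..n}. \<bar>w r c\<bar> > ?b}"
            using I J by blast
        qed
        also have "\<dots> \<le> (\<phi> i - 1) * n" by (rule large[OF \<phi>[OF i]])
        finally show "real (card {(r, c) \<in> I \<times> J. \<bar>w r c\<bar> > ?b}) \<le> real ((\<phi> i - 1) * n)"
          by (simp only: of_nat_le_iff)
        show "real (card (injections I J)) \<le> 2 * real m" using S by (simp add: m_def)
      qed auto
      also have "\<dots> \<le> (2 * real m) * (real (\<phi> i - 1) * 2)"
      proof (intro mult_left_mono)
        have "real n / real (card J) \<le> 2" using IJ(2) cJ by (simp add: divide_le_eq)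
        then have "real (\<phi> i - 1) * (real n / real (card J)) \<le> real (\<phi> i - 1) * 2"
          by (rule mult_left_mono) simp
        then show "real ((\<phi> i - 1) * n) / real (card J) \<le> real (\<phi> i - 1) * 2" by simp
      qed simp
      also have "\<dots> = real (m * (4 * (\<phi> i - 1)))" by simp
      also have "\<dots> \<le> real (m * (i - 1))"
      proof -
        have "4 * (\<phi> i - 1) \<le> i - 1" by (simp add: \<phi>_def)
        then show ?thesis by (simp only: of_nat_le_iff mult_le_mono2)
      qed
      finally show ?thesis by (simp only: of_nat_le_iff)
    qed
    obtain k where k: "k \<in> {1..m}" "N (?v (g k)) \<le> K * N (\<lambda>i. y (\<phi> i))"
      using Dstar_convex_vectors[OF D K m, of "\<lambda>i. y (\<phi> i)" "\<lambda>k. ?v (g k)"] y \<phi> count by blast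
    \<comment> \<open>The dilation costs exactly the 4 built into \<open>?t\<close>, so the vector
      found has norm at most \<open>?t\<close>, although all vectors in \<open>?S\<close> exceed
      \<open>?t\<close>.\<close>
    have "N (\<lambda>i. y (\<phi> i)) \<le> real 4 * N y"
    proof (rule norm_dilation_le[of 4 \<phi> y])
      fix i j assume ij: "i \<in> {1..n}" "j \<in> {1..n}" "\<phi> i = \<phi> j" "i mod 4 = j mod 4"
      have "4 * \<phi> l \<le> l + 3 \<and> l \<le> 4 * \<phi> l" if "l \<in> {1..n}" for l
        using that unfolding \<phi>_def atLeastAtMost_iff by presburger
      from this[OF ij(1)] this[OF ij(2)] have close: "i < j + 4" "j < i + 4"
        using ij(3) by linarith+
      have split: "l = 4 * (l div 4) + l mod 4" for l :: nat by simp
      consider "i div 4 < j div 4" | "j div 4 < i div 4" | "i div 4 = j div 4" by linarith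
      then show "i = j"
        by cases (use split[of i] split[of j] ij(4) close in linarith)+
    qed (use \<phi> in auto)
    then have "K * N (\<lambda>i. y (\<phi> i)) \<le> ?t"
      using K mult_left_mono[of "N (\<lambda>i. y (\<phi> i))" "4 * N y" K] by simp
    moreover have "?t < N (?v (g k))"
      using bij_betwE[OF g] k(1) by blast
    ultimately show False using k(2) by linarith
  qed
qed

text \<open>
  The \<open>n\<close> largest entries are estimated in \<open>\<ell>\<^sub>1\<close>. The others are at most \<open>x\<^sub>n\<^sup>*\<close>, and each half of
  the rows leaves enough free columns for the two previous lemmas.
\<close>

lemma upper_bound:
  assumes D: "Dstar_convex_with K (ri_carrier n) (ri_norm n N)" and K: "K > 0"
  shows "perm_average n N x \<le> (16 * K + 4) * rearr_bound n N x"
proof -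
  obtain e where e: "bij_betw e {1..n * n} ({1..n} \<times> {1..n})"
    "\<And>k. k \<in> {1..n * n} \<Longrightarrow> matrix_rearr n x k = \<bar>x (fst (e k)) (snd (e k))\<bar>"
    "\<And>k l. 1 \<le> k \<Longrightarrow> k \<le> l \<Longrightarrow> l \<le> n * n \<Longrightarrow> matrix_rearr n x l \<le> matrix_rearr n x k"
    by (metis matrix_rearr_enumeration)
  let ?avg = "inj_average {1..n} {1..n}"
  define X where "X = matrix_rearr n x"
  define y where "y = (\<lambda>k. X (k * n))"
  \<comment> \<open>The large entries are removed by cell and not by value, so exactly
    \<open>n\<close> cells are removed even if there are ties at the threshold.\<close>
  define w where "w i j = (if (i, j) \<in> e ` {1..n} then 0 else x i j)" for i j
  define w' where "w' i j = (if (i, j) \<in> e ` {1..n} then x i j else 0)" for i j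
  have nn: "n \<le> n * n" by simp
  have qn: "q * n \<in> {1..n * n}" if "q \<in> {1..n}" for q using that by auto
  have y0: "y q \<ge> 0" if "q \<in> {1..n}" for q
    using e(2)[OF qn[OF that]] by (simp add: y_def X_def)
  have small: "\<exists>l\<in>{n<..n * n}. (i, j) = e l \<and> \<bar>w i j\<bar> = X l"
    if "i \<in> {1..n}" "j \<in> {1..n}" "w i j \<noteq> 0" for i j
  proof -
    have "(i, j) \<in> e ` {1..n * n}" using that e(1) by (simp add: bij_betw_def)
    then obtain l where l: "l \<in> {1..n * n}" "(i, j) = e l" by blast
    have ne: "(i, j) \<notin> e ` {1..n}" using that(3) by (auto simp: w_def)
    then have "l > n" using l by (auto simp: not_le[symmetric])
    moreover have "\<bar>w i j\<bar> = X l"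
      using ne e(2)[OF l(1)] by (simp add: w_def X_def l(2)[symmetric])
    ultimately show ?thesis using l by auto
  qed
  have w_le: "\<bar>w i j\<bar> \<le> y 1" if ij: "i \<in> {1..n}" "j \<in> {1..n}" for i j
  proof (cases "w i j = 0")
    case True
    then show ?thesis using y0[of 1] dim_pos by simp
  next
    case False
    then obtain l where "l \<in> {n<..n * n}" "\<bar>w i j\<bar> = X l" using small[OF ij False] by blast
    then show ?thesis using e(3)[of n l] dim_pos by (simp add: y_def X_def)
  qed
  have large: "card {(r, c) \<in> {1..n} \<times> {1..n}. \<bar>w r c\<bar> > y q} \<le> (q - 1) * n"
    if q: "q \<in> {1..n}" for q
  proof -
    \<comment> \<open>An entry of \<open>w\<close> above \<open>y q\<close> has rank greater than
      \<open>n\<close>, as it was not removed, and smaller than \<open>q * n\<close>. This gains the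
      \<open>q - 1\<close> required for rearrangements sampled at left endpoints.\<close>
    have "{(r, c) \<in> {1..n} \<times> {1..n}. \<bar>w r c\<bar> > y q} \<subseteq> e ` {n<..<q * n}"
    proof safe
      fix r c assume rc: "r \<in> {1..n}" "c \<in> {1..n}" "y q < \<bar>w r c\<bar>"
      then have "w r c \<noteq> 0" using y0[OF q] by auto
      then obtain l where l: "l \<in> {n<..n * n}" "(r, c) = e l" "\<bar>w r c\<bar> = X l"
        using small[OF rc(1,2)] by blast
      have "\<not> q * n \<le> l"
        using e(3)[of "q * n" l] qn[OF q] l(1,3) rc(3) by (auto simp: y_def X_def)
      then show "(r, c) \<in> e ` {n<..<q * n}" using l by auto
    qed
    then have "card {(r, c) \<in> {1..n} \<times> {1..n}. \<bar>w r c\<bar> > y q} \<le> card {n<..<q * n}"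
      by (meson card_image_le card_mono finite_greaterThanLessThan finite_imageI le_trans)
    also have "\<dots> \<le> (q - 1) * n" by (simp add: diff_mult_distrib)
    finally show ?thesis .
  qed
  let ?t = "4 * K * N y"
  have half: "inj_average I J (\<lambda>\<sigma>. of_bool (?t < N (\<lambda>i. if i \<in> I then w i (\<sigma> i) else 0))) \<le> 1 / 2"
    if "I \<subseteq> {1..n}" "J \<subseteq> {1..n}" "n + 2 * card I \<le> 2 * card J + 1" for I J
    using D K y0 large that by (rule half_of_Dstar_convex)
  have t: "?t \<ge> 0" using K nonneg[of y] by simp
  have part: "?avg (\<lambda>\<sigma>. N (\<lambda>i. if i \<in> I then w i (\<sigma> i) else 0)) \<le> 2 * (?t + y 1)"
    if "I \<subseteq> {1..n}" "n + 2 * card I \<le> 2 * n + 1" for I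
    using t w_le half that by (rule average_le_of_half)
  \<comment> \<open>The larger half has at most (n + 1)/2 rows; for odd \<open>n\<close> this uses
    the \<open>+ 1\<close> in the side condition.\<close>
  let ?I = "{1..n div 2}" and ?I' = "{n div 2 + 1..n}"
  have sub: "?I \<subseteq> {1..n}" "?I' \<subseteq> {1..n}" by auto
  have card: "n + 2 * card ?I \<le> 2 * n + 1" "n + 2 * card ?I' \<le> 2 * n + 1"
    by simp_all
  have "N (\<lambda>i. x i (\<sigma> i)) \<le> (\<Sum>i\<in>{1..n}. \<bar>w' i (\<sigma> i)\<bar>) +
      (N (\<lambda>i. if i \<in> ?I then w i (\<sigma> i) else 0) + N (\<lambda>i. if i \<in> ?I' then w i (\<sigma> i) else 0))" for \<sigma>
  proof -
    have "N (\<lambda>i. x i (\<sigma> i)) = N (\<lambda>i. w' i (\<sigma> i) + w i (\<sigma> i))"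
      by (intro coordinates) (simp add: w_def w'_def)
    also have "\<dots> \<le> N (\<lambda>i. w' i (\<sigma> i)) + N (\<lambda>i. w i (\<sigma> i))" by (rule triangle)
    also have "N (\<lambda>i. w' i (\<sigma> i)) \<le> (\<Sum>i\<in>{1..n}. \<bar>w' i (\<sigma> i)\<bar>)" by (rule norm_le_sum)
    also have "N (\<lambda>i. w i (\<sigma> i)) = N (\<lambda>i. (if i \<in> ?I then w i (\<sigma> i) else 0) + (if i \<in> ?I' then w i (\<sigma> i) else 0))"
      by (intro coordinates) auto
    also have "\<dots> \<le> N (\<lambda>i. if i \<in> ?I then w i (\<sigma> i) else 0) + N (\<lambda>i. if i \<in> ?I' then w i (\<sigma> i) else 0)"
      by (rule triangle)
    finally show ?thesis by simp
  qed
  then have "perm_average n N x \<le> ?avg (\<lambda>\<sigma>. (\<Sum>i\<in>{1..n}. \<bar>w' i (\<sigma> i)\<bar>) +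
      (N (\<lambda>i. if i \<in> ?I then w i (\<sigma> i) else 0) + N (\<lambda>i. if i \<in> ?I' then w i (\<sigma> i) else 0)))"
    unfolding perm_average_eq by (rule inj_average_mono)
  also have "\<dots> = ?avg (\<lambda>\<sigma>. \<Sum>i\<in>{1..n}. \<bar>w' i (\<sigma> i)\<bar>) +
      (?avg (\<lambda>\<sigma>. N (\<lambda>i. if i \<in> ?I then w i (\<sigma> i) else 0)) + ?avg (\<lambda>\<sigma>. N (\<lambda>i. if i \<in> ?I' then w i (\<sigma> i) else 0)))"
    by (simp only: inj_average_add)
  also have "\<dots> \<le> ?avg (\<lambda>\<sigma>. \<Sum>i\<in>{1..n}. \<bar>w' i (\<sigma> i)\<bar>) + (2 * (?t + y 1) + 2 * (?t + y 1))"
    by (intro add_left_mono add_mono part sub card)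
  \<comment> \<open>Each cell is hit with probability 1/n, and \<open>w'\<close> is supported on the
    cells of rank at most \<open>n\<close>.\<close>
  also have "?avg (\<lambda>\<sigma>. \<Sum>i\<in>{1..n}. \<bar>w' i (\<sigma> i)\<bar>) = 1 / real n * (\<Sum>k=1..n. X k)"
  proof -
    have "?avg (\<lambda>\<sigma>. \<Sum>i\<in>{1..n}. \<bar>w' i (\<sigma> i)\<bar>) = (\<Sum>i\<in>{1..n}. (\<Sum>j\<in>{1..n}. \<bar>w' i j\<bar>) / real (card {1..n}))"
      unfolding inj_average_sum
      by (intro sum.cong refl inj_average_marginal[where g = "\<lambda>c. \<bar>w' _ c\<bar>"]) auto
    also have "\<dots> = 1 / real n * (\<Sum>p\<in>{1..n} \<times> {1..n}. \<bar>w' (fst p) (snd p)\<bar>)"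
      by (simp add: sum_divide_distrib[symmetric] sum.cartesian_product case_prod_unfold)
    also have "(\<Sum>p\<in>{1..n} \<times> {1..n}. \<bar>w' (fst p) (snd p)\<bar>) = (\<Sum>l\<in>{1..n * n}. \<bar>w' (fst (e l)) (snd (e l))\<bar>)"
      by (rule sum.reindex_bij_betw[OF e(1), symmetric])
    also have "\<dots> = (\<Sum>l\<in>{1..n}. X l)"
    proof (rule sum.mono_neutral_cong_right)
      show "{1..n} \<subseteq> {1..n * n}" using nn by (auto intro: order_trans)
      show "\<forall>l\<in>{1..n * n} - {1..n}. \<bar>w' (fst (e l)) (snd (e l))\<bar> = 0"
      proof
        fix l assume l: "l \<in> {1..n * n} - {1..n}"
        have "e l \<notin> e ` {1..n}"
        proof
          assume "e l \<in> e ` {1..n}"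
          then obtain l' where "l' \<in> {1..n}" "e l = e l'" by blast
          then show False
            using inj_onD[OF bij_betw_imp_inj_on[OF e(1)], of l l'] l nn by (auto intro: order_trans)
        qed
        then show "\<bar>w' (fst (e l)) (snd (e l))\<bar> = 0" by (simp add: w'_def)
      qed
      fix l assume l: "l \<in> {1..n}"
      then have "l \<in> {1..n * n}" using nn by (auto intro: order_trans)
      then show "\<bar>w' (fst (e l)) (snd (e l))\<bar> = X l"
        using l e(2)[of l] by (simp add: w'_def X_def)
    qed simp
    finally show ?thesis .
  qed
  finally have "perm_average n N x \<le> 1 / real n * (\<Sum>k=1..n. X k) + 4 * (?t + y 1)" by simp
  \<comment> \<open>Here \<open>y 1\<close> is the bound on the entries of \<open>w\<close>;
    absorbing it turns \<open>4 * (?t + y 1)\<close> into \<open>(16 * K + 4) * N y\<close>.\<close>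
  also have "y 1 \<le> N y"
    using abs_coordinate_le[of 1 y] dim_pos by simp
  finally have "perm_average n N x \<le> 1 / real n * (\<Sum>k=1..n. X k) + (16 * K + 4) * N y"
    by (simp add: algebra_simps)
  moreover have "0 \<le> 1 / real n * (\<Sum>k=1..n. X k)"
  proof (intro mult_nonneg_nonneg sum_nonneg)
    fix l assume "l \<in> {1..n}"
    then have "l \<in> {1..n * n}" using nn by (auto intro: order_trans)
    then show "0 \<le> X l" using e(2) by (simp add: X_def)
  qed simp
  then have "1 * (1 / real n * (\<Sum>k=1..n. X k)) \<le> (16 * K + 4) * (1 / real n * (\<Sum>k=1..n. X k))"
    using K by (intro mult_right_mono) auto
  ultimately show ?thesis
    by (simp add: rearr_bound_def X_def[symmetric] y_def[symmetric] distrib_left)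
qed

end

text \<open>The content lies in the uniformity of the constants in \<open>n\<close>: for a single
  \<open>n\<close>, both sides are comparable with the largest entry. The first constant is
  absolute, the second depends on the space only through \<open>K\<close>.\<close>

theorem theorem27:
  shows "(\<exists>c>0::real. \<forall>(n::nat) (N :: (nat \<Rightarrow> real) \<Rightarrow> real) (x :: nat \<Rightarrow> nat \<Rightarrow> real).
      symmetric_sequence_space n N \<and> N (\<lambda>i. if i = 1 then 1 else 0) = 1 \<longrightarrow>
      perm_average n N x \<ge> inverse c * rearr_bound n N x) \<and>
    (\<forall>K>0::real. \<exists>c>0::real. \<forall>(n::nat) (N :: (nat \<Rightarrow> real) \<Rightarrow> real) (x :: nat \<Rightarrow> nat \<Rightarrow> real).
      symmetric_sequence_space n N \<and> N (\<lambda>i. if i = 1 then 1 else 0) = 1 \<and>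
      Dstar_convex_with K (ri_carrier n) (ri_norm n N) \<longrightarrow>
      perm_average n N x \<le> c * rearr_bound n N x)"
proof (intro conjI allI impI)
  show "\<exists>c>0::real. \<forall>n N x. symmetric_sequence_space n N \<and> N (\<lambda>i. if i = 1 then 1 else 0) = 1 \<longrightarrow>
      perm_average n N x \<ge> inverse c * rearr_bound n N x"
  proof (intro exI[of _ 26] conjI allI impI)
    fix n N x
    assume "symmetric_sequence_space n N \<and> N (\<lambda>i. if i = 1 then 1 else 0) = 1"
    then interpret normalized_sequence_space n N
      by (simp add: normalized_sequence_space_def normalized_sequence_space_axioms_def)
    show "perm_average n N x \<ge> inverse 26 * rearr_bound n N x" by (rule lower_bound)
  qed simp
next
  fix K :: real assume K: "K > 0"
  show "\<exists>c>0::real. \<forall>n N x. symmetric_sequence_space n N \<and> N (\<lambda>i. if i = 1 then 1 else 0) = 1 \<and>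
      Dstar_convex_with K (ri_carrier n) (ri_norm n N) \<longrightarrow> perm_average n N x \<le> c * rearr_bound n N x"
  proof (intro exI[of _ "16 * K + 4"] conjI allI impI)
    fix n N x
    assume *: "symmetric_sequence_space n N \<and> N (\<lambda>i. if i = 1 then 1 else 0) = 1 \<and>
      Dstar_convex_with K (ri_carrier n) (ri_norm n N)"
    then interpret normalized_sequence_space n N
      by (simp add: normalized_sequence_space_def normalized_sequence_space_axioms_def)
    show "perm_average n N x \<le> (16 * K + 4) * rearr_bound n N x"
      using * K by (intro upper_bound) auto
  qed (use K in simp)
qed

end
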